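(* Let $T>0$, let $f:\mathbb{R}\to\mathbb{R}$ be Lipschitz with $f(0)=0$ and such that $f'(0)$ exists, let $u_0\in BV(\mathbb{R})\cap L^1(\mathbb{R})$ be nonnegative, and let $x_0^1<\dots<x_0^N$ be real numbers. Let $v$, $v_0$ and $A$ be the approximation, initial approximation and interpolated velocity field of the particle path scheme (see context). Then $$\int_0^T\int_{\mathbb{R}}\bigl(\partial_t\varphi(x,t)+A(x,t)\,\partial_x\varphi(x,t)\bigr)v(x,t)\,dx\,dt+\int_{\mathbb{R}}\varphi(x,0)\,v_0(x)\,dx=0$$ for all $\varphi\in C_c^\infty(\mathbb{R}\times[0,T))$.
   Context: $\chi_I$ is the indicator function of $I$. Velocity function: $a(v)=f(v)/v$ for $v\ne0$, $a(0)=f'(0)$; $V(v_l,v_r)=\min_{v\in[v_l,v_r]}a(v)$ if $0\le v_l\le v_r$, and $V(v_l,v_r)=\max_{v\in[v_r,v_l]}a(v)$ if $0\le v_r\le v_l$. Particle path scheme. Initialization: set $x_0^0=-\infty$, $x_0^{N+1}=+\infty$, $v_0^i=\frac{1}{x_0^{i+1}-x_0^i}\int_{x_0^i}^{x_0^{i+1}}u_0\,dx$ for $1\le i\le N-1$, $v_0^0=v_0^N=0$, and $v_0(x)=\sum_{i=0}^N v_0^i\chi_{(x_0^i,x_0^{i+1})}(x)$. For all $t$ put $x_t^0=-\infty$, $x_t^{N+1}=+\infty$, $v_t^0=v_t^N=0$. Stages: $t_0=0$, $\mathcal{I}_0=\{1,\dots,N\}$. At stage $j$, with time $t_j<T$,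 remaining index set $\mathcal{I}_j\ni N$, $N_j=|\mathcal{I}_j|$, let $\pi_j:\{1,\dots,N_j\}\to\mathcal{I}_j$ be the increasing bijection, extended by $\pi_j(0)=0$, $\pi_j(N_j+1)=N+1$. On $(t_j,t_{j+1})$ the positions $x_t^{\pi_j(i)}$, $1\le i\le N_j$, are $C^1$, strictly increasing in $i$, and solve $\dot x_t^{\pi_j(i)}=V(v_t^{\pi_j(i-1)},v_t^{\pi_j(i)})$ with the values at $t_j$ as initial data, where for $1\le i\le N_j-1$ $$v_t^{\pi_j(i)}=\frac{x_{t_j}^{\pi_j(i+1)}-x_{t_j}^{\pi_j(i)}}{x_t^{\pi_j(i+1)}-x_t^{\pi_j(i)}}\,v_{t_j}^{\pi_j(i)}.$$ Here $t_{j+1}\in(t_j,T]$ is the first time at which two or more particles meet, or $T$ if there is no such time before $T$. Values at $t_{j+1}$ are limits as $t\uparrow t_{j+1}$. Put $\mathcal{I}_{j+1}=\{\pi_j(i): 1\le i\le N_j,\ x_{t_{j+1}}^{\pi_j(i)}\ne x_{t_{j+1}}^{\pi_j(i+1)}\}$ (the leftmost particles of each collision and their densities are deleted), define $N_{j+1},\pi_{j+1}$ accordingly, and continue from $t_{j+1}$ with the remaining particles and densities; stop when $t_{j+1}=T$. There are finitely many stages, and the solutions on each stage exist and are unique. Approximation: $v(x,t)=\sum_{i=0}^{N_j}v_t^{\pi_j(i)}\chi_{(x_t^{\pi_j(i)},x_t^{\pi_j(i+1)})}(x)$ for $t\in[t_j,t_{j+1})$, and with the final index set at $t=T$. Velocity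 field: for $t\in[t_j,t_{j+1})$ (and at $t=T$ with the final index set), $$A(x,t)=\frac{x_t^{\pi_j(i+1)}-x}{x_t^{\pi_j(i+1)}-x_t^{\pi_j(i)}}V(v_t^{\pi_j(i-1)},v_t^{\pi_j(i)})+\frac{x-x_t^{\pi_j(i)}}{x_t^{\pi_j(i+1)}-x_t^{\pi_j(i)}}V(v_t^{\pi_j(i)},v_t^{\pi_j(i+1)})$$ for $x\in[x_t^{\pi_j(i)},x_t^{\pi_j(i+1)}]$, $1\le i\le N_j-1$, and $A(\cdot,t)$ is constant to the left of the first and to the right of the last remaining particle, with the value of $V$ at that particle. *)

theory Defs
  imports "HOL-Analysis.Analysis"
begin

definition velocity :: "(real \<Rightarrow> real) \<Rightarrow> real \<Rightarrow> real" where
  "velocity f v = (if v = 0 then deriv f 0 else f v / v)"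

text \<open>Only arguments with \<open>0 \<le> vl\<close> and \<open>0 \<le> vr\<close> matter; there the extrema are attained when \<open>f\<close>
  is Lipschitz with \<open>f 0 = 0\<close> and differentiable at 0.\<close>

definition particle_velocity :: "(real \<Rightarrow> real) \<Rightarrow> real \<Rightarrow> real \<Rightarrow> real" where
  "particle_velocity f vl vr =
     (if vl \<le> vr then (LEAST y. y \<in> velocity f ` {vl..vr})
      else (GREATEST y. y \<in> velocity f ` {vr..vl}))"

definition extended_pos :: "nat \<Rightarrow> (nat \<Rightarrow> real) \<Rightarrow> nat \<Rightarrow> ereal" where
  "extended_pos N p i = (if i = 0 then -\<infinity> else if i = N + 1 then \<infinity> else ereal (p i))"

text \<open>The increasing bijection from \<open>{1..card S}\<close> onto \<open>S\<close>, extended to \<open>0\<close> and \<open>card S + 1\<close>.\<close>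

definition enum_index :: "nat \<Rightarrow> nat set \<Rightarrow> nat \<Rightarrow> nat" where
  "enum_index N S i =
     (if i = 0 then 0 else if i = card S + 1 then N + 1 else sorted_list_of_set S ! (i - 1))"

definition initial_dens :: "(real \<Rightarrow> real) \<Rightarrow> nat \<Rightarrow> (nat \<Rightarrow> real) \<Rightarrow> nat \<Rightarrow> real" where
  "initial_dens u0 N x0 i =
     (if 1 \<le> i \<and> i + 1 \<le> N
      then (1 / (x0 (i + 1) - x0 i)) * (LINT y:{x0 i..x0 (i + 1)}|lebesgue. u0 y)
      else 0)"

definition initial_approx :: "(real \<Rightarrow> real) \<Rightarrow> nat \<Rightarrow> (nat \<Rightarrow> real) \<Rightarrow> real \<Rightarrow> real" where
  "initial_approx u0 N x0 y =
     (\<Sum>i=0..N. initial_dens u0 N x0 i *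
        indicator {extended_pos N x0 i<..<extended_pos N x0 (i + 1)} (ereal y))"

text \<open>A run of the scheme: stage \<open>j\<close> (for \<open>j < num_stages\<close>) lasts from \<open>stage_time j\<close> to
  \<open>stage_time (j + 1)\<close> and has the remaining indices \<open>remaining j\<close>; \<open>remaining num_stages\<close> is the
  final index set. \<open>pos i t\<close> and \<open>dens i t\<close> carry no information once particle \<open>i\<close> has been
  deleted.\<close>

record particle_run =
  num_stages :: nat
  stage_time :: "nat \<Rightarrow> real"
  remaining :: "nat \<Rightarrow> nat set"
  pos :: "nat \<Rightarrow> real \<Rightarrow> real"
  dens :: "nat \<Rightarrow> real \<Rightarrow> real"

text \<open>Continuity of the positions on the closed time interval expresses both the initial data of the
  stage and the values at its end as limits. The densities of surviving particles at the end of
  the stage are limits from the left; those of deleted ones are left unspecified there.\<close>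

definition particle_stage :: "(real \<Rightarrow> real) \<Rightarrow> real \<Rightarrow> nat \<Rightarrow> particle_run \<Rightarrow> nat \<Rightarrow> bool" where
  "particle_stage f T N r j \<longleftrightarrow>
    (let n = card (remaining r j);
         p = enum_index N (remaining r j);
         s = stage_time r j;
         s' = stage_time r (j + 1)
     in s < s' \<and> s' \<le> T \<and>
        (\<forall>i\<in>{1..n}.
           continuous_on {s..s'} (pos r (p i)) \<and>
           pos r (p i) C1_differentiable_on {s<..<s'} \<and>
           (\<forall>t\<in>{s<..<s'}.
              (pos r (p i) has_real_derivative
                 particle_velocity f (dens r (p (i - 1)) t) (dens r (p i) t)) (at t))) \<and>
        (\<forall>t\<in>{s<..<s'}. strict_mono_on {1..n} (\<lambda>i. pos r (p i) t)) \<and>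
        (\<forall>i\<in>{1..<n}. \<forall>t\<in>{s..<s'}.
           dens r (p i) t =
             (pos r (p (i + 1)) s - pos r (p i) s) / (pos r (p (i + 1)) t - pos r (p i) t)
               * dens r (p i) s) \<and>
        (s' = T \<or> (\<exists>i\<in>{1..<n}. pos r (p i) s' = pos r (p (i + 1)) s')) \<and>
        remaining r (j + 1) =
          {p i | i. i \<in> {1..n} \<and>
             extended_pos N (\<lambda>k. pos r k s') (p i) \<noteq> extended_pos N (\<lambda>k. pos r k s') (p (i + 1))} \<and>
        (\<forall>i\<in>remaining r (j + 1). (dens r i \<longlongrightarrow> dens r i s') (at_left s')))"

definition particle_path_scheme ::
  "(real \<Rightarrow> real) \<Rightarrow> (real \<Rightarrow> real) \<Rightarrow> real \<Rightarrow> nat \<Rightarrow> (nat \<Rightarrow> real) \<Rightarrow> particle_run \<Rightarrow> bool" where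
  "particle_path_scheme f u0 T N x0 r \<longleftrightarrow>
     stage_time r 0 = 0 \<and> stage_time r (num_stages r) = T \<and>
     remaining r 0 = {1..N} \<and>
     (\<forall>i\<in>{1..N}. pos r i 0 = x0 i) \<and>
     (\<forall>i\<in>{0..N}. dens r i 0 = initial_dens u0 N x0 i) \<and>
     (\<forall>t. dens r 0 t = 0 \<and> dens r N t = 0) \<and>
     (\<forall>j<num_stages r. particle_stage f T N r j)"

text \<open>For a run, this is the \<open>j\<close> with \<open>stage_time j \<le> t < stage_time (j + 1)\<close>, and
  \<open>num_stages\<close> at the final time.\<close>

definition stage_at :: "particle_run \<Rightarrow> real \<Rightarrow> nat" where
  "stage_at r t = Max {j. j \<le> num_stages r \<and> stage_time r j \<le> t}"

definition particle_approx :: "nat \<Rightarrow> particle_run \<Rightarrow> real \<Rightarrow> real \<Rightarrow> real" where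
  "particle_approx N r y t =
    (let S = remaining r (stage_at r t);
         p = enum_index N S;
         X = extended_pos N (\<lambda>k. pos r k t)
     in \<Sum>i=0..card S. dens r (p i) t * indicator {X (p i)<..<X (p (i + 1))} (ereal y))"

text \<open>At a particle position the two adjacent interpolation formulas agree, so it does not matter
  which cell such a point is assigned to.\<close>

definition velocity_field ::
  "(real \<Rightarrow> real) \<Rightarrow> nat \<Rightarrow> particle_run \<Rightarrow> real \<Rightarrow> real \<Rightarrow> real" where
  "velocity_field f N r y t =
    (let S = remaining r (stage_at r t);
         n = card S;
         p = enum_index N S;
         x = (\<lambda>i. pos r (p i) t);
         W = (\<lambda>i. particle_velocity f (dens r (p (i - 1)) t) (dens r (p i) t))
     in if y \<le> x 1 then W 1
        else if x n \<le> y then W n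
        else let i = Max {i. 1 \<le> i \<and> i \<le> n \<and> x i \<le> y}
             in (x (i + 1) - y) / (x (i + 1) - x i) * W i
                + (y - x i) / (x (i + 1) - x i) * W (i + 1))"

text \<open>Bounded variation in the distributional sense, which does not depend on the choice of
  a representative.\<close>

definition bounded_variation :: "(real \<Rightarrow> real) \<Rightarrow> bool" where
  "bounded_variation u \<longleftrightarrow>
     (\<forall>a b. set_integrable lebesgue {a..b} u) \<and>
     (\<exists>C. \<forall>\<psi>. \<psi> C1_differentiable_on UNIV \<and> (\<exists>K. compact K \<and> (\<forall>y. y \<notin> K \<longrightarrow> \<psi> y = 0)) \<and>
             (\<forall>y. \<bar>\<psi> y\<bar> \<le> 1) \<longrightarrow>
             (LINT y|lebesgue. u y * deriv \<psi> y) \<le> C)"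

text \<open>Continuous differentiability relative to a set. It is used below on a convex set with
  nonempty interior, where derivatives within the set are unique and are one-sided at the
  boundary.\<close>

primrec Ck_on :: "nat \<Rightarrow> ('a::real_normed_vector \<Rightarrow> real) \<Rightarrow> 'a set \<Rightarrow> bool" where
  "Ck_on 0 g S \<longleftrightarrow> continuous_on S g"
| "Ck_on (Suc k) g S \<longleftrightarrow>
     (\<exists>g'. (\<forall>z\<in>S. (g has_derivative g' z) (at z within S)) \<and> (\<forall>h. Ck_on k (\<lambda>z. g' z h) S))"

text \<open>Smooth compactly supported functions on \<open>\<real> \<times> [0,T)\<close>; they need not vanish at time 0, and
  their values outside this set are irrelevant.\<close>

definition test_functions :: "real \<Rightarrow> (real \<times> real \<Rightarrow> real) set" where
  "test_functions T =
     {\<phi>. (\<forall>k. Ck_on k \<phi> (UNIV \<times> {0..<T})) \<and>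
         (\<exists>K. compact K \<and> K \<subseteq> UNIV \<times> {0..<T} \<and> (\<forall>z\<in>UNIV \<times> {0..<T} - K. \<phi> z = 0))}"

end

theory Submission
  imports Defs
begin

text \<open>Between two collision times each cell \<open>[x\<^sub>i, x\<^sub>i\<^sub>+\<^sub>1]\<close> carries a constant mass \<open>m\<^sub>i\<close>, and the
  interpolated velocity field is the one that transports every point
  \<open>x\<^sub>i + \<theta> (x\<^sub>i\<^sub>+\<^sub>1 - x\<^sub>i)\<close> with \<open>\<theta> \<in> [0,1]\<close> fixed. Hence the integral of \<open>\<phi>(\<cdot>,t)\<close> against the
  approximation is \<open>\<Sum>\<^sub>i m\<^sub>i \<integral>\<^sub>0\<^sup>1 \<phi>(x\<^sub>i + \<theta> (x\<^sub>i\<^sub>+\<^sub>1 - x\<^sub>i), t) d\<theta>\<close>, and differentiating under the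
  integral sign shows that its time derivative is exactly the inner integral of the weak
  formulation (\<open>cell_mean_has_derivative\<close>, \<open>weak_integrand_eq\<close>). The fundamental theorem of calculus
  then evaluates the contribution of one stage (\<open>stage_integral\<close>).

  The contributions telescope if nothing is lost when particles are deleted, that is, if every
  cell that collapses is empty (\<open>collapse_mass_zero\<close>). This is a maximum principle: a cell at least
  as dense as its two neighbours cannot shrink, since \<open>V\<close> is a minimum over increasing and a
  maximum over decreasing states (\<open>particle_velocity_le_at_local_max\<close>). So the densities stay
  bounded during the stage (\<open>density_bounded\<close>), whereas a positive mass in a vanishing cell would
  make the density blow up. Here the nonnegativity of the initial densities enters.

  What remains of the telescoping sum is the term at the final time, which vanishes because the
  support of \<open>\<phi>\<close> stays away from \<open>T\<close>, and the initial term of the weak formulation.\<close>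

section \<open>Particle velocities\<close>

lemma isCont_velocity:
  assumes "L-lipschitz_on UNIV f" and "f 0 = 0" and "f differentiable (at 0)"
  shows "isCont (velocity f) v"
proof (cases "v = 0")
  case True
  have "(f has_real_derivative deriv f 0) (at 0)"
    using assms(3) DERIV_deriv_iff_real_differentiable by blast
  then have "((\<lambda>h. f h / h) \<longlongrightarrow> deriv f 0) (at 0)"
    using assms(2) by (simp add: DERIV_def)
  then have "(velocity f \<longlongrightarrow> deriv f 0) (at 0)"
    by (rule filterlim_cong[THEN iffD1, OF refl refl, rotated])
       (auto simp: velocity_def eventually_at_filter)
  then show ?thesis
    using True by (simp add: isCont_def velocity_def)
next
  case False
  have "continuous_on UNIV f"
    using assms(1) lipschitz_on_continuous_on by blast
  then have "isCont f v"
    by (simp add: continuous_on_eq_continuous_at)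
  then have "isCont (\<lambda>w. f w / w) v"
    using False by (auto intro!: continuous_intros)
  moreover have "\<forall>\<^sub>F w in nhds v. f w / w = velocity f w"
    using t1_space_nhds[OF False] by (rule eventually_mono) (simp add: velocity_def)
  ultimately show ?thesis
    using isCont_cong[of "\<lambda>w. f w / w" "velocity f" v] by simp
qed

text \<open>The bound at \<open>0\<close> follows from the bound elsewhere by continuity.\<close>

lemma abs_velocity_le:
  assumes "L-lipschitz_on UNIV f" and "f 0 = 0" and "f differentiable (at 0)"
  shows "\<bar>velocity f v\<bar> \<le> L"
proof -
  have off: "\<bar>velocity f w\<bar> \<le> L" if "w \<noteq> 0" for w
    using lipschitz_onD[OF assms(1), of w 0] that assms(2)
    by (simp add: velocity_def dist_real_def divide_simps)
  show ?thesis
  proof (cases "v = 0")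
    case True
    have "(velocity f \<longlongrightarrow> velocity f 0) (at 0)"
      using isCont_velocity[OF assms, of 0] by (simp add: isCont_def)
    then have "((\<lambda>w. \<bar>velocity f w\<bar>) \<longlongrightarrow> \<bar>velocity f 0\<bar>) (at 0)"
      by (rule tendsto_rabs)
    then have "\<bar>velocity f 0\<bar> \<le> L"
      by (rule tendsto_upperbound) (auto simp: eventually_at_filter off)
    then show ?thesis using True by simp
  qed (use off in blast)
qed

text \<open>Continuity of the velocity function makes the extrema attained, so the values given by
  the operators LEAST and GREATEST are genuine minima and maxima.\<close>

lemma particle_velocity_min:
  assumes "L-lipschitz_on UNIV f" and "f 0 = 0" and "f differentiable (at 0)" and "vl \<le> vr"
  shows "particle_velocity f vl vr \<in> velocity f ` {vl..vr}"
    and "w \<in> {vl..vr} \<Longrightarrow> particle_velocity f vl vr \<le> velocity f w"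
proof -
  have "continuous_on {vl..vr} (velocity f)"
    using isCont_velocity[OF assms(1-3)] by (simp add: continuous_at_imp_continuous_on)
  then obtain y where y: "y \<in> {vl..vr}" "\<forall>w\<in>{vl..vr}. velocity f y \<le> velocity f w"
    using continuous_attains_inf[of "{vl..vr}" "velocity f"] assms(4) by auto
  have "(LEAST z. z \<in> velocity f ` {vl..vr}) = velocity f y"
    by (rule Least_equality) (use y in auto)
  then show "particle_velocity f vl vr \<in> velocity f ` {vl..vr}"
    and "w \<in> {vl..vr} \<Longrightarrow> particle_velocity f vl vr \<le> velocity f w"
    using y assms(4) by (auto simp: particle_velocity_def)
qed

lemma particle_velocity_max:
  assumes "L-lipschitz_on UNIV f" and "f 0 = 0" and "f differentiable (at 0)" and "vr \<le> vl"
  shows "particle_velocity f vl vr \<in> velocity f ` {vr..vl}"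
    and "w \<in> {vr..vl} \<Longrightarrow> velocity f w \<le> particle_velocity f vl vr"
proof -
  have "continuous_on {vr..vl} (velocity f)"
    using isCont_velocity[OF assms(1-3)] by (simp add: continuous_at_imp_continuous_on)
  then obtain y where y: "y \<in> {vr..vl}" "\<forall>w\<in>{vr..vl}. velocity f w \<le> velocity f y"
    using continuous_attains_sup[of "{vr..vl}" "velocity f"] assms(4) by auto
  have "(GREATEST z. z \<in> velocity f ` {vr..vl}) = velocity f y"
    by (rule Greatest_equality) (use y in auto)
  moreover have "particle_velocity f vl vr = velocity f vl" if "vl = vr"
    using particle_velocity_min(1)[OF assms(1-3), of vl vr] that by simp
  ultimately show "particle_velocity f vl vr \<in> velocity f ` {vr..vl}"
    and "w \<in> {vr..vl} \<Longrightarrow> velocity f w \<le> particle_velocity f vl vr"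
    using y assms(4) by (cases "vl = vr"; auto simp: particle_velocity_def)+
qed

lemma abs_particle_velocity_le:
  assumes "L-lipschitz_on UNIV f" and "f 0 = 0" and "f differentiable (at 0)"
  shows "\<bar>particle_velocity f vl vr\<bar> \<le> L"
proof -
  have "particle_velocity f vl vr \<in> range (velocity f)"
    using particle_velocity_min(1)[OF assms, of vl vr] particle_velocity_max(1)[OF assms, of vr vl]
    by (cases "vl \<le> vr") auto
  then show ?thesis
    using abs_velocity_le[OF assms] by auto
qed

text \<open>A cell that is at least as dense as both of its neighbours does not shrink: its left end
  moves at most as fast, and its right end at least as fast, as the velocity belonging to its
  own density.\<close>

lemma particle_velocity_le_at_local_max:
  assumes "L-lipschitz_on UNIV f" and "f 0 = 0" and "f differentiable (at 0)"
    and "vl \<le> v" and "vr \<le> v"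
  shows "particle_velocity f vl v \<le> particle_velocity f v vr"
  using particle_velocity_min(2)[OF assms(1-4), of v]
    particle_velocity_max(2)[OF assms(1-3,5), of v] assms(4,5) by auto

section \<open>A maximum principle for finitely many functions of time\<close>

text \<open>The derivative is only known to be nonpositive where a member of the family attains the
  maximum over the family. Subtracting \<open>\<epsilon> (t - s)\<close> makes it negative there, so the joint maximum
  over the index and the time interval can only sit at the initial time.\<close>

lemma finite_family_maximum_principle:
  fixes w :: "'i \<Rightarrow> real \<Rightarrow> real"
  assumes fin: "finite I" and cont: "\<And>i. i \<in> I \<Longrightarrow> continuous_on {s..u} (w i)"
    and deriv: "\<And>i t. i \<in> I \<Longrightarrow> s < t \<Longrightarrow> t \<le> u \<Longrightarrow> (\<forall>k\<in>I. w k t \<le> w i t) \<Longrightarrow>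
                  \<exists>d\<le>0. (w i has_real_derivative d) (at t)"
    and init: "\<And>i. i \<in> I \<Longrightarrow> w i s \<le> M"
    and i: "i \<in> I" and t: "t \<in> {s..u}"
  shows "w i t \<le> M"
proof -
  have perturbed: "w i t - \<epsilon> * (t - s) \<le> M" if \<epsilon>: "\<epsilon> > 0" for \<epsilon>
  proof -
    define h where "h k \<tau> = w k \<tau> - \<epsilon> * (\<tau> - s)" for k \<tau>
    have "\<exists>\<tau>\<in>{s..u}. \<forall>\<sigma>\<in>{s..u}. h k \<sigma> \<le> h k \<tau>" if "k \<in> I" for k
      using t cont[OF that] unfolding h_def
      by (intro continuous_attains_sup) (auto intro!: continuous_intros)
    then obtain \<tau> where \<tau>: "\<And>k. k \<in> I \<Longrightarrow> \<tau> k \<in> {s..u}"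
      "\<And>k \<sigma>. k \<in> I \<Longrightarrow> \<sigma> \<in> {s..u} \<Longrightarrow> h k \<sigma> \<le> h k (\<tau> k)"
      by metis
    have "Max ((\<lambda>k. h k (\<tau> k)) ` I) \<in> (\<lambda>k. h k (\<tau> k)) ` I"
      using fin i by (intro Max_in) auto
    then obtain m where m: "m \<in> I" "h m (\<tau> m) = Max ((\<lambda>k. h k (\<tau> k)) ` I)"
      by auto
    have top: "h k \<sigma> \<le> h m (\<tau> m)" if "k \<in> I" "\<sigma> \<in> {s..u}" for k \<sigma>
    proof -
      have "h k (\<tau> k) \<le> h m (\<tau> m)"
        unfolding m(2) using fin that by (intro Max_ge) auto
      then show ?thesis using \<tau>(2)[OF that] by simp
    qed
    have "\<tau> m = s"
    proof (rule ccontr)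
      assume "\<tau> m \<noteq> s"
      then have tm: "s < \<tau> m" "\<tau> m \<le> u" using \<tau>(1)[OF m(1)] by auto
      have "\<forall>k\<in>I. w k (\<tau> m) \<le> w m (\<tau> m)"
        using top[of _ "\<tau> m"] tm by (auto simp: h_def)
      then obtain d where d: "d \<le> 0" "(w m has_real_derivative d) (at (\<tau> m))"
        using deriv[OF m(1) tm] by blast
      have "(h m has_real_derivative d - \<epsilon>) (at (\<tau> m))"
        unfolding h_def by (auto intro!: derivative_eq_intros d(2))
      then obtain e where e: "e > 0" "\<forall>x>0. x < e \<longrightarrow> h m (\<tau> m) < h m (\<tau> m - x)"
        using DERIV_neg_dec_left[of "h m" "d - \<epsilon>" "\<tau> m"] d(1) \<epsilon> by auto
      define x where "x = min (e / 2) (\<tau> m - s)"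
      have x: "0 < x" "x < e" "\<tau> m - x \<in> {s..u}"
        using e(1) tm by (auto simp: x_def min_def)
      show False
        using e(2) x top[OF m(1) x(3)] by fastforce
    qed
    then have "h i t \<le> w m s"
      using top[OF i t] by (simp add: h_def)
    then show ?thesis
      using init[OF m(1)] by (simp add: h_def)
  qed
  have "w i t \<le> M + e" if "e > 0" for e
  proof -
    have "e / (1 + (t - s)) * (t - s) \<le> e"
      using that t by (simp add: divide_simps)
    then show ?thesis
      using perturbed[of "e / (1 + (t - s))"] that t by simp
  qed
  then show ?thesis by (rule field_le_epsilon)
qed

section \<open>Test functions\<close>

text \<open>Values of a test function \<open>\<phi>\<close> outside \<open>\<real> \<times> [0,T)\<close> are arbitrary; replacing them by \<open>0\<close>
  gives a function \<open>\<psi>\<close> that is continuous up to the final time, because the support stays away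
  from it. The partial derivatives are kept for positive times only, where they are two-sided and
  agree with the derivatives along the coordinate lines.\<close>

locale extended_test_function =
  fixes T :: real and \<phi> \<psi> \<phi>x \<phi>t :: "real \<times> real \<Rightarrow> real" and C :: real
  assumes \<psi>_cont: "continuous_on (UNIV \<times> {0..T}) \<psi>"
    and \<psi>_eq: "\<And>x t. t \<in> {0..<T} \<Longrightarrow> \<psi> (x, t) = \<phi> (x, t)"
    and \<psi>_final: "\<And>x. \<psi> (x, T) = 0"
    and \<psi>_deriv: "\<And>z. z \<in> UNIV \<times> {0<..<T} \<Longrightarrow>
            (\<psi> has_derivative (\<lambda>h. fst h * \<phi>x z + snd h * \<phi>t z)) (at z)"
    and \<phi>x_cont: "continuous_on (UNIV \<times> {0<..<T}) \<phi>x"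
    and \<phi>t_cont: "continuous_on (UNIV \<times> {0<..<T}) \<phi>t"
    and \<phi>x_bound: "\<And>z. z \<in> UNIV \<times> {0<..<T} \<Longrightarrow> \<bar>\<phi>x z\<bar> \<le> C"
    and \<phi>t_bound: "\<And>z. z \<in> UNIV \<times> {0<..<T} \<Longrightarrow> \<bar>\<phi>t z\<bar> \<le> C"
    and deriv_space: "\<And>x t. t \<in> {0<..<T} \<Longrightarrow> deriv (\<lambda>y. \<phi> (y, t)) x = \<phi>x (x, t)"
    and deriv_time: "\<And>x t. t \<in> {0<..<T} \<Longrightarrow> deriv (\<lambda>s. \<phi> (x, s)) t = \<phi>t (x, t)"

lemma test_function_extension:
  assumes "\<phi> \<in> test_functions T"
  obtains \<psi> \<phi>x \<phi>t C where "extended_test_function T \<phi> \<psi> \<phi>x \<phi>t C"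
proof -
  define S0 :: "(real \<times> real) set" where "S0 = UNIV \<times> {0<..<T}"
  define S1 :: "(real \<times> real) set" where "S1 = UNIV \<times> {0..<T}"
  have open0: "open S0" unfolding S0_def by (intro open_Times) auto
  have sub: "S0 \<subseteq> S1" unfolding S0_def S1_def by auto
  have Ck: "\<And>k. Ck_on k \<phi> S1"
    using assms by (simp add: test_functions_def S1_def)
  obtain K where K: "compact K" "K \<subseteq> S1" "\<And>z. z \<in> S1 - K \<Longrightarrow> \<phi> z = 0"
  proof -
    have "\<exists>K. compact K \<and> K \<subseteq> S1 \<and> (\<forall>z\<in>S1 - K. \<phi> z = 0)"
      using assms by (simp add: test_functions_def S1_def)
    then show ?thesis using that by (elim exE conjE) (simp only: Ball_def)
  qed
  have contS1: "continuous_on S1 \<phi>" using Ck[of 0] by simp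
  obtain g where g: "\<And>z. z \<in> S1 \<Longrightarrow> (\<phi> has_derivative g z) (at z within S1)"
    "\<And>h. continuous_on S1 (\<lambda>z. g z h)"
    using Ck[of "Suc 0"] by auto
  have der: "(\<phi> has_derivative g z) (at z)" if "z \<in> S0" for z
    using has_derivative_subset[OF g(1) sub] that sub at_within_open[OF that open0]
    by (metis subsetD)
  have lin: "g z h = fst h * g z (1, 0) + snd h * g z (0, 1)" if "z \<in> S0" for z h
  proof -
    interpret bounded_linear "g z" using der[OF that] by (rule has_derivative_bounded_linear)
    have "h = fst h *\<^sub>R (1, 0) + snd h *\<^sub>R (0, 1)" by (simp add: prod_eq_iff)
    then have "g z h = g z (fst h *\<^sub>R (1, 0) + snd h *\<^sub>R (0, 1))" by simp
    then show ?thesis by (simp only: add scaleR real_scaleR_def)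
  qed
  have zero: "g z h = 0" if "z \<in> S0 - K" for z h
  proof -
    have "open (S0 - K)" using open0 K(1) by (simp add: compact_imp_closed open_Diff)
    then have "(\<phi> has_derivative (\<lambda>h. 0)) (at z)"
      by (rule has_derivative_transform_within_open[OF has_derivative_const[of 0] _ that])
         (use K(3) sub in auto)
    then have "g z = (\<lambda>h. 0)" using der[of z] that has_derivative_unique by blast
    then show ?thesis by simp
  qed
  have bnd: "\<exists>B. \<forall>z\<in>S0. \<bar>g z h\<bar> \<le> B" for h
  proof -
    have "compact ((\<lambda>z. g z h) ` K)"
      by (intro compact_continuous_image continuous_on_subset[OF g(2)] K)
    then obtain B where B: "\<forall>y\<in>(\<lambda>z. g z h) ` K. norm y \<le> B"
      using compact_imp_bounded bounded_iff by metis
    have "\<bar>g z h\<bar> \<le> \<bar>B\<bar>" if "z \<in> S0" for z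
      using B zero[of z h] that by (cases "z \<in> K") force+
    then show ?thesis by blast
  qed
  obtain B1 B2 where B: "\<And>z. z \<in> S0 \<Longrightarrow> \<bar>g z (1, 0)\<bar> \<le> B1" "\<And>z. z \<in> S0 \<Longrightarrow> \<bar>g z (0, 1)\<bar> \<le> B2"
    using bnd[of "(1, 0)"] bnd[of "(0, 1)"] by auto
  define \<psi> where "\<psi> z = (if snd z < T then \<phi> z else 0)" for z :: "real \<times> real"
  define Z :: "(real \<times> real) set" where "Z = UNIV \<times> {0..T} - K"
  have U: "S1 \<union> Z = UNIV \<times> {0..T}" using K(2) by (auto simp: S1_def Z_def)
  have "continuous_on (S1 \<union> Z) \<psi>"
  proof (rule continuous_on_Un_local_open)
    have "S1 = (UNIV \<times> {0..T}) \<inter> (UNIV \<times> {..<T})" by (auto simp: S1_def)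
    then show "openin (top_of_set (S1 \<union> Z)) S1"
      unfolding U by (metis openin_open_Int open_Times open_UNIV open_lessThan)
    have "Z = (UNIV \<times> {0..T}) \<inter> (- K)" by (auto simp: Z_def)
    then show "openin (top_of_set (S1 \<union> Z)) Z"
      unfolding U by (metis openin_open_Int compact_imp_closed K(1) open_Compl)
    show "continuous_on S1 \<psi>"
      by (rule continuous_on_eq[OF contS1]) (auto simp: \<psi>_def S1_def)
    show "continuous_on Z \<psi>"
      by (rule continuous_on_eq[OF continuous_on_const[of _ 0]])
         (use K(3) in \<open>auto simp: \<psi>_def Z_def S1_def\<close>)
  qed
  then have c\<psi>: "continuous_on (UNIV \<times> {0..T}) \<psi>" by (simp add: U)
  have d\<psi>: "(\<psi> has_derivative (\<lambda>h. fst h * g z (1, 0) + snd h * g z (0, 1))) (at z)"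
    if z: "z \<in> S0" for z
  proof -
    have "(\<psi> has_derivative g z) (at z)"
      by (rule has_derivative_transform_within_open[OF der[OF z] open0 z])
         (auto simp: \<psi>_def S0_def)
    moreover have "g z = (\<lambda>h. fst h * g z (1, 0) + snd h * g z (0, 1))"
      using lin[OF z] by blast
    ultimately show ?thesis by simp
  qed
  have dx: "deriv (\<lambda>y. \<phi> (y, t)) x = g (x, t) (1, 0)" if "t \<in> {0<..<T}" for x t
  proof -
    have z: "(x, t) \<in> S0" using that by (simp add: S0_def)
    have "((\<lambda>y. (y, t)) has_derivative (\<lambda>h. (h, 0))) (at x)"
      by (intro has_derivative_Pair has_derivative_ident has_derivative_const)
    from has_derivative_compose[OF this der[OF z]]
    have "((\<lambda>y. \<phi> (y, t)) has_derivative (\<lambda>h. g (x, t) (h, 0))) (at x)"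
      .
    moreover have "g (x, t) (h, 0) = g (x, t) (1, 0) * h" for h
      using lin[OF z, of "(h, 0)"] by simp
    then have "(\<lambda>h. g (x, t) (h, 0)) = (*) (g (x, t) (1, 0))" by blast
    ultimately have "((\<lambda>y. \<phi> (y, t)) has_real_derivative g (x, t) (1, 0)) (at x)"
      by (simp add: has_field_derivative_def)
    then show ?thesis by (rule DERIV_imp_deriv)
  qed
  have dt: "deriv (\<lambda>s. \<phi> (x, s)) t = g (x, t) (0, 1)" if "t \<in> {0<..<T}" for x t
  proof -
    have z: "(x, t) \<in> S0" using that by (simp add: S0_def)
    have "((\<lambda>s. (x, s)) has_derivative (\<lambda>h. (0, h))) (at t)"
      by (intro has_derivative_Pair has_derivative_ident has_derivative_const)
    from has_derivative_compose[OF this der[OF z]]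
    have "((\<lambda>s. \<phi> (x, s)) has_derivative (\<lambda>h. g (x, t) (0, h))) (at t)"
      .
    moreover have "g (x, t) (0, h) = g (x, t) (0, 1) * h" for h
      using lin[OF z, of "(0, h)"] by simp
    then have "(\<lambda>h. g (x, t) (0, h)) = (*) (g (x, t) (0, 1))" by blast
    ultimately have "((\<lambda>s. \<phi> (x, s)) has_real_derivative g (x, t) (0, 1)) (at t)"
      by (simp add: has_field_derivative_def)
    then show ?thesis by (rule DERIV_imp_deriv)
  qed
  show thesis
  proof (rule that[of \<psi> "\<lambda>z. g z (1, 0)" "\<lambda>z. g z (0, 1)" "max B1 B2"], unfold_locales)
    show "\<bar>g z (1, 0)\<bar> \<le> max B1 B2" "\<bar>g z (0, 1)\<bar> \<le> max B1 B2"
      if "z \<in> UNIV \<times> {0<..<T}" for z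
      using B[of z] that by (auto simp: S0_def)
    show "continuous_on (UNIV \<times> {0<..<T}) (\<lambda>z. g z (1, 0))"
      "continuous_on (UNIV \<times> {0<..<T}) (\<lambda>z. g z (0, 1))"
      using continuous_on_subset[OF g(2) sub] by (simp_all add: S0_def)
    show "(\<psi> has_derivative (\<lambda>h. fst h * g z (1, 0) + snd h * g z (0, 1))) (at z)"
      if "z \<in> UNIV \<times> {0<..<T}" for z
      using d\<psi> that unfolding S0_def by blast
  qed (use c\<psi> dx dt in \<open>simp_all add: \<psi>_def\<close>)
qed

section \<open>Averages over a moving cell\<close>

text \<open>Parametrising the cell by \<open>\<theta> \<in> [0,1]\<close> keeps the mean value defined and continuous in time
  when the cell collapses to a point.\<close>

definition cell_mean :: "(real \<times> real \<Rightarrow> real) \<Rightarrow> real \<Rightarrow> real \<Rightarrow> real \<Rightarrow> real" where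
  "cell_mean g a b t = integral {0..1} (\<lambda>\<theta>. g (a + \<theta> * (b - a), t))"

lemma cell_integral_eq:
  fixes g h :: "real \<Rightarrow> real"
  assumes "a < b" and "continuous_on {a..b} g" and "\<And>y. y \<in> {a<..<b} \<Longrightarrow> h y = g y"
  shows "integrable lebesgue (\<lambda>y. h y * indicator {a<..<b} y)"
    and "(LINT y|lebesgue. h y * indicator {a<..<b} y)
           = (b - a) * integral {0..1} (\<lambda>\<theta>. g (a + \<theta> * (b - a)))"
proof -
  have "g absolutely_integrable_on {a..b}"
    using assms(2) by (rule absolutely_integrable_continuous_real)
  then have gi: "g absolutely_integrable_on {a<..<b}"
    by (rule set_integrable_subset) auto
  have eq: "(\<lambda>y. h y * indicator {a<..<b} y) = (\<lambda>y. indicator {a<..<b} y *\<^sub>R g y)"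
    using assms(3) by (auto simp: indicator_def fun_eq_iff)
  show "integrable lebesgue (\<lambda>y. h y * indicator {a<..<b} y)"
    using gi by (simp add: eq set_integrable_def)
  have "(LINT y|lebesgue. h y * indicator {a<..<b} y) = (LINT y:{a<..<b}|lebesgue. g y)"
    by (simp add: eq set_lebesgue_integral_def)
  also have "\<dots> = integral {a<..<b} g"
    using gi by (rule set_lebesgue_integral_eq_integral)
  also have "\<dots> = integral {a..b} g"
    by (simp add: integral_open_interval_real)
  finally have I: "(LINT y|lebesgue. h y * indicator {a<..<b} y) = integral {a..b} g" .
  have "((\<lambda>\<theta>. (b - a) *\<^sub>R g (a + \<theta> * (b - a)))
      has_integral integral {a + 0 * (b - a)..a + 1 * (b - a)} g) {0..1}"
  proof (rule has_integral_substitution[where c = a and d = b])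
    show "(\<lambda>\<theta>. a + \<theta> * (b - a)) ` {0..1} \<subseteq> {a..b}"
    proof
      fix y assume "y \<in> (\<lambda>\<theta>. a + \<theta> * (b - a)) ` {0..1}"
      then obtain \<theta> where \<theta>: "0 \<le> \<theta>" "\<theta> \<le> 1" "y = a + \<theta> * (b - a)" by auto
      then show "y \<in> {a..b}"
        using assms(1) mult_left_le_one_le[of "b - a" \<theta>]
        mult_nonneg_nonneg[of \<theta> "b - a"] unfolding atLeastAtMost_iff by linarith
    qed
  qed (use assms in \<open>auto intro!: derivative_eq_intros\<close>)
  then have "((\<lambda>\<theta>. (b - a) *\<^sub>R g (a + \<theta> * (b - a))) has_integral integral {a..b} g) {0..1}"
    by simp
  then have "integral {a..b} g = integral {0..1} (\<lambda>\<theta>. (b - a) * g (a + \<theta> * (b - a)))"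
    by (simp add: has_integral_iff)
  then show "(LINT y|lebesgue. h y * indicator {a<..<b} y)
           = (b - a) * integral {0..1} (\<lambda>\<theta>. g (a + \<theta> * (b - a)))"
    using I by simp
qed

lemma continuous_on_cell_mean:
  assumes "continuous_on (UNIV \<times> J) \<psi>" and "continuous_on J x" and "continuous_on J y"
  shows "continuous_on J (\<lambda>t. cell_mean \<psi> (x t) (y t) t)"
proof -
  have "continuous_on (J \<times> cbox 0 1) (\<lambda>p. \<psi> (x (fst p) + snd p * (y (fst p) - x (fst p)), fst p))"
    by (rule continuous_on_compose2[OF assms(1)])
       (auto intro!: continuous_intros continuous_on_compose2[OF assms(2)]
             continuous_on_compose2[OF assms(3)])
  then have "continuous_on J (\<lambda>t. integral (cbox 0 1) (\<lambda>\<theta>. \<psi> (x t + \<theta> * (y t - x t), t)))"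
    by (intro integral_continuous_on_param) (simp add: case_prod_unfold)
  then show ?thesis by (simp add: cell_mean_def)
qed

text \<open>In the coordinate \<open>\<theta>\<close> the points of the cell move along characteristics of the linearly
  interpolated velocity field, so the time derivative of the average is the average of the
  material derivative.\<close>

lemma cell_mean_has_derivative:
  assumes J: "open J" "convex J" and t: "t \<in> J"
    and \<psi>: "\<And>z. z \<in> UNIV \<times> J \<Longrightarrow> (\<psi> has_derivative (\<lambda>h. fst h * \<phi>x z + snd h * \<phi>t z)) (at z)"
    and c: "continuous_on (UNIV \<times> J) \<phi>x" "continuous_on (UNIV \<times> J) \<phi>t"
    and x: "\<And>\<tau>. \<tau> \<in> J \<Longrightarrow> (x has_real_derivative x' \<tau>) (at \<tau>)" "continuous_on J x'"
    and y: "\<And>\<tau>. \<tau> \<in> J \<Longrightarrow> (y has_real_derivative y' \<tau>) (at \<tau>)" "continuous_on J y'"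
  shows "((\<lambda>t. cell_mean \<psi> (x t) (y t) t) has_real_derivative
      integral {0..1} (\<lambda>\<theta>. \<phi>t (x t + \<theta> * (y t - x t), t)
        + ((1 - \<theta>) * x' t + \<theta> * y' t) * \<phi>x (x t + \<theta> * (y t - x t), t))) (at t)"
proof -
  define D where "D \<tau> \<theta> = \<phi>t (x \<tau> + \<theta> * (y \<tau> - x \<tau>), \<tau>)
        + ((1 - \<theta>) * x' \<tau> + \<theta> * y' \<tau>) * \<phi>x (x \<tau> + \<theta> * (y \<tau> - x \<tau>), \<tau>)" for \<tau> \<theta>
  have cx: "continuous_on J x" and cy: "continuous_on J y"
    by (rule DERIV_continuous_on, erule has_field_derivative_at_within[OF x(1)])
       (rule DERIV_continuous_on, erule has_field_derivative_at_within[OF y(1)])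
  have c\<psi>: "continuous_on (UNIV \<times> J) \<psi>"
    by (rule has_derivative_continuous_on, erule has_derivative_at_withinI[OF \<psi>])
  have point: "((\<lambda>\<tau>. \<psi> (x \<tau> + \<theta> * (y \<tau> - x \<tau>), \<tau>)) has_field_derivative D \<tau> \<theta>) (at \<tau> within J)"
    if "\<tau> \<in> J" for \<tau> \<theta>
  proof -
    let ?z = "(x \<tau> + \<theta> * (y \<tau> - x \<tau>), \<tau>)"
    have "((\<lambda>\<tau>. x \<tau> + \<theta> * (y \<tau> - x \<tau>)) has_real_derivative x' \<tau> + \<theta> * (y' \<tau> - x' \<tau>)) (at \<tau>)"
      by (intro DERIV_add DERIV_cmult DERIV_diff x(1) y(1) that)
    then have inner: "((\<lambda>\<tau>. (x \<tau> + \<theta> * (y \<tau> - x \<tau>), \<tau>)) has_derivative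
        (\<lambda>h. ((x' \<tau> + \<theta> * (y' \<tau> - x' \<tau>)) * h, h))) (at \<tau>)"
      unfolding has_field_derivative_def by (rule has_derivative_Pair[OF _ has_derivative_ident])
    have z: "?z \<in> UNIV \<times> J" using that by simp
    have "((\<lambda>\<tau>. \<psi> (x \<tau> + \<theta> * (y \<tau> - x \<tau>), \<tau>)) has_derivative
        (\<lambda>h. fst ((x' \<tau> + \<theta> * (y' \<tau> - x' \<tau>)) * h, h) * \<phi>x ?z
             + snd ((x' \<tau> + \<theta> * (y' \<tau> - x' \<tau>)) * h, h) * \<phi>t ?z)) (at \<tau>)"
      by (rule has_derivative_compose[OF inner \<psi>[OF z]])
    then have "((\<lambda>\<tau>. \<psi> (x \<tau> + \<theta> * (y \<tau> - x \<tau>), \<tau>)) has_field_derivative D \<tau> \<theta>) (at \<tau>)"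
      unfolding has_field_derivative_def D_def
      by (rule has_derivative_eq_rhs) (auto simp: algebra_simps)
    then show ?thesis by (rule has_field_derivative_at_within)
  qed
  have "continuous_on (J \<times> cbox 0 1) (\<lambda>p. D (fst p) (snd p))"
    unfolding D_def
  proof -
    have "continuous_on (J \<times> cbox 0 1) (\<lambda>p. (x (fst p) + snd p * (y (fst p) - x (fst p)), fst p))"
      by (intro continuous_intros continuous_on_compose2[OF cx] continuous_on_compose2[OF cy]) auto
    note pos = continuous_on_compose2[OF c(1) this] continuous_on_compose2[OF c(2) this]
    have "continuous_on (J \<times> cbox 0 1) (\<lambda>p. x' (fst p))" "continuous_on (J \<times> cbox 0 1) (\<lambda>p. y' (fst p))"
      by (rule continuous_on_compose2[OF x(2)] continuous_on_compose2[OF y(2)];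
          auto intro!: continuous_intros)+
    note vel = this
    show "continuous_on (J \<times> cbox 0 1) (\<lambda>p. \<phi>t (x (fst p) + snd p * (y (fst p) - x (fst p)), fst p)
        + ((1 - snd p) * x' (fst p) + snd p * y' (fst p))
          * \<phi>x (x (fst p) + snd p * (y (fst p) - x (fst p)), fst p))"
      by (intro continuous_on_add continuous_on_mult continuous_on_diff continuous_on_const
          continuous_on_snd continuous_on_id vel pos) auto
  qed
  then have cD: "continuous_on (J \<times> cbox 0 1) (\<lambda>(\<tau>, \<theta>). D \<tau> \<theta>)"
    by (simp add: case_prod_unfold)
  have "((\<lambda>t. integral (cbox 0 1) (\<lambda>\<theta>. \<psi> (x t + \<theta> * (y t - x t), t)))
      has_field_derivative integral (cbox 0 1) (D t)) (at t within J)"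
  proof (rule leibniz_rule_field_derivative[OF point _ cD t J(2)])
    show "(\<lambda>\<theta>. \<psi> (x \<tau> + \<theta> * (y \<tau> - x \<tau>), \<tau>)) integrable_on cbox 0 1" if "\<tau> \<in> J" for \<tau>
      by (rule integrable_continuous, rule continuous_on_compose2[OF c\<psi>])
         (use that in \<open>auto intro!: continuous_intros\<close>)
  qed
  then show ?thesis
    using at_within_open[OF t J(1)] by (simp add: cell_mean_def D_def[abs_def])
qed

text \<open>The velocity at \<open>\<theta>\<close> is a convex combination of the velocities of the two ends, so it obeys
  the same bound.\<close>

lemma abs_integral_material_derivative_le:
  fixes a b p q :: "real \<Rightarrow> real"
  assumes "continuous_on {0..1} a" "continuous_on {0..1} b"
    and "\<And>\<theta>. \<theta> \<in> {0..1} \<Longrightarrow> \<bar>a \<theta>\<bar> \<le> C" "\<And>\<theta>. \<theta> \<in> {0..1} \<Longrightarrow> \<bar>b \<theta>\<bar> \<le> C"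
    and "\<bar>u\<bar> \<le> L" "\<bar>w\<bar> \<le> L"
  shows "\<bar>integral {0..1} (\<lambda>\<theta>. a \<theta> + ((1 - \<theta>) * u + \<theta> * w) * b \<theta>)\<bar> \<le> C + L * C"
proof -
  have "norm (integral {0..1} (\<lambda>\<theta>. a \<theta> + ((1 - \<theta>) * u + \<theta> * w) * b \<theta>)) \<le> (C + L * C) * (1 - 0)"
  proof (rule integral_bound)
    show "continuous_on {0..1} (\<lambda>\<theta>. a \<theta> + ((1 - \<theta>) * u + \<theta> * w) * b \<theta>)"
      by (intro continuous_intros assms)
    show "norm (a \<theta> + ((1 - \<theta>) * u + \<theta> * w) * b \<theta>) \<le> C + L * C" if \<theta>: "\<theta> \<in> {0..1}" for \<theta>
    proof -
      have "\<bar>(1 - \<theta>) * u + \<theta> * w\<bar> \<le> (1 - \<theta>) * L + \<theta> * L"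
        using \<theta> assms(5,6)
        by (intro order_trans[OF abs_triangle_ineq] add_mono) (auto simp: abs_mult mult_left_mono)
      then have "\<bar>((1 - \<theta>) * u + \<theta> * w) * b \<theta>\<bar> \<le> L * C"
        unfolding abs_mult using assms(4)[OF \<theta>] assms(5)
        by (intro mult_mono) (auto simp: algebra_simps)
      then show ?thesis using assms(3)[OF \<theta>] by simp
    qed
  qed simp
  then show ?thesis by simp
qed

section \<open>Increasing enumeration of the remaining particles\<close>

lemma enum_index_0 [simp]: "enum_index N S 0 = 0"
  by (simp add: enum_index_def)

lemma enum_index_nth:
  "i \<in> {1..card S} \<Longrightarrow> enum_index N S i = sorted_list_of_set S ! (i - 1)"
  by (auto simp: enum_index_def)

lemma strict_mono_on_enum_index: "strict_mono_on {1..card S} (enum_index N S)"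
proof (rule strict_mono_onI)
  fix i k assume "i \<in> {1..card S}" "k \<in> {1..card S}" "i < k"
  then show "enum_index N S i < enum_index N S k"
    using sorted_wrt_nth_less[OF strict_sorted_list_of_set, of "i - 1" "k - 1" S]
    by (auto simp: enum_index_nth)
qed

lemma enum_index_image:
  assumes "finite S"
  shows "enum_index N S ` {1..card S} = S"
proof -
  have "enum_index N S ` {1..card S} = (\<lambda>i. sorted_list_of_set S ! (i - 1)) ` {1..card S}"
    by (rule image_cong) (auto simp: enum_index_nth)
  also have "\<dots> = (\<lambda>i. sorted_list_of_set S ! i) ` ((\<lambda>i. i - 1) ` {1..card S})"
    by (simp add: image_image)
  also have "(\<lambda>i. i - 1) ` {1..card S} = {0..<card S}"
    by (force simp: image_iff intro: bexI[of _ "Suc _"])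
  also have "(\<lambda>i. sorted_list_of_set S ! i) ` {0..<card S} = S"
    using assms by (metis length_sorted_list_of_set list.set_map map_nth set_sorted_list_of_set set_upt)
  finally show ?thesis .
qed

lemma enum_index_card:
  assumes "S \<subseteq> {1..N}" and "N \<in> S"
  shows "enum_index N S (card S) = N"
proof -
  have fin: "finite S" using assms(1) finite_subset by blast
  obtain i where i: "i \<in> {1..card S}" "enum_index N S i = N"
    using enum_index_image[OF fin, of N] assms(2) by (metis imageE)
  have "enum_index N S (card S) \<in> S"
    using enum_index_image[OF fin, of N] i(1) by fastforce
  then have "enum_index N S (card S) \<le> N" using assms(1) by auto
  then show ?thesis
    using strict_mono_onD[OF strict_mono_on_enum_index[of S N] i(1), of "card S"] i
    by (cases "i = card S") auto
qed

lemma bij_betw_enum_index: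
  assumes "S \<subseteq> {1..N}" and "N \<in> S"
  shows "bij_betw (enum_index N S) {1..<card S} (S - {N})"
proof -
  have fin: "finite S" using assms(1) finite_subset by blast
  have pos: "1 \<le> card S" using assms(2) fin by (metis One_nat_def Suc_leI card_gt_0_iff empty_iff)
  have bij: "bij_betw (enum_index N S) {1..card S} S"
    unfolding bij_betw_def using enum_index_image[OF fin] strict_mono_on_imp_inj_on[OF strict_mono_on_enum_index]
    by blast
  have "bij_betw (enum_index N S) ({1..card S} - {card S}) (S - {N})"
    using bij_betw_DiffI[OF bij, of "{card S}" "{N}"] enum_index_card[OF assms] pos assms(2)
    by (simp add: bij_betw_def)
  moreover have "{1..card S} - {card S} = {1..<card S}" by auto
  ultimately show ?thesis by simp
qed

text \<open>Sums over labels rather than over positions in the enumeration make the index sets before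
  and after a deletion comparable, because the surviving labels form a subset. For this the right
  neighbour has to be expressed through labels as well.\<close>

definition successor_in :: "nat set \<Rightarrow> nat \<Rightarrow> nat" where
  "successor_in S k = Min {l \<in> S. k < l}"

lemma successor_in_enum_index:
  assumes "finite S" and i: "i \<in> {1..<card S}"
  shows "successor_in S (enum_index N S i) = enum_index N S (i + 1)"
  unfolding successor_in_def
proof (rule Min_eqI)
  have mono: "enum_index N S a < enum_index N S b" if "1 \<le> a" "a < b" "b \<le> card S" for a b
    using strict_mono_onD[OF strict_mono_on_enum_index[of S N], of a b] that by auto
  show "finite {l \<in> S. enum_index N S i < l}" using assms(1) by simp
  have "enum_index N S (i + 1) \<in> S"
    using enum_index_image[OF assms(1), of N] i by fastforce
  then show "enum_index N S (i + 1) \<in> {l \<in> S. enum_index N S i < l}"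
    using mono[of i "i + 1"] i by simp
  fix l assume l: "l \<in> {l \<in> S. enum_index N S i < l}"
  then obtain k where k: "k \<in> {1..card S}" "l = enum_index N S k"
    using enum_index_image[OF assms(1), of N] by blast
  have "i < k"
  proof (rule ccontr)
    assume "\<not> i < k"
    then have "enum_index N S k \<le> enum_index N S i"
      using mono[of k i] k(1) i by (cases "k = i") auto
    then show False using l k(2) by simp
  qed
  then show "enum_index N S (i + 1) \<le> l"
    using mono[of "i + 1" k] k by (cases "k = i + 1") auto
qed

lemma sum_over_cells:
  assumes "S \<subseteq> {1..N}" and "N \<in> S"
  shows "(\<Sum>i\<in>{1..<card S}. h (enum_index N S i) (enum_index N S (i + 1)))
       = (\<Sum>k\<in>S - {N}. h k (successor_in S k))"
proof -
  have "finite S" using assms(1) finite_subset by blast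
  then have "(\<Sum>i\<in>{1..<card S}. h (enum_index N S i) (enum_index N S (i + 1)))
      = (\<Sum>i\<in>{1..<card S}. h (enum_index N S i) (successor_in S (enum_index N S i)))"
    by (intro sum.cong) (simp_all only: successor_in_enum_index)
  also have "\<dots> = (\<Sum>k\<in>S - {N}. h k (successor_in S k))"
    by (rule sum.reindex_bij_betw[OF bij_betw_enum_index[OF assms]])
  finally show ?thesis .
qed

text \<open>The integral of \<open>\<psi>(\<cdot>,t)\<close> against the piecewise constant density carried by the labels
  in \<open>S\<close>, written as a sum of cell masses times cell averages.\<close>

definition weighted_mass ::
  "(real \<times> real \<Rightarrow> real) \<Rightarrow> nat \<Rightarrow> particle_run \<Rightarrow> nat set \<Rightarrow> real \<Rightarrow> real" where
  "weighted_mass \<psi> N r S t =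
     (\<Sum>k\<in>S - {N}. dens r k t * (pos r (successor_in S k) t - pos r k t)
        * cell_mean \<psi> (pos r k t) (pos r (successor_in S k) t) t)"

text \<open>The properties that the initial data of a stage inherit from the previous one; deletion
  restores the strict order of the positions.\<close>

definition admissible_start :: "nat \<Rightarrow> particle_run \<Rightarrow> nat \<Rightarrow> bool" where
  "admissible_start N r j \<longleftrightarrow>
     remaining r j \<subseteq> {1..N} \<and> N \<in> remaining r j \<and>
     strict_mono_on (remaining r j) (\<lambda>k. pos r k (stage_time r j)) \<and>
     (\<forall>k\<in>remaining r j. 0 \<le> dens r k (stage_time r j))"

section \<open>A single stage\<close>

text \<open>The last hypothesis fixes the position of the stage within the run, which alone decides at
  which times the approximation and the velocity field refer to it.\<close>

locale scheme_stage =
  fixes f :: "real \<Rightarrow> real" and L T :: real and N :: nat and r :: particle_run and j :: nat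
  assumes lipschitz: "L-lipschitz_on UNIV f" and f_0: "f 0 = 0" and f_diff: "f differentiable (at 0)"
    and stage: "particle_stage f T N r j"
    and start: "admissible_start N r j" and time_nonneg: "0 \<le> stage_time r j"
    and boundary: "\<And>t. dens r 0 t = 0" "\<And>t. dens r N t = 0"
    and stage_at: "\<And>t. stage_time r j \<le> t \<Longrightarrow> t < stage_time r (j + 1) \<Longrightarrow> stage_at r t = j"
begin

abbreviation "S \<equiv> remaining r j"
abbreviation "S' \<equiv> remaining r (j + 1)"
abbreviation "n \<equiv> card (remaining r j)"
abbreviation "p \<equiv> enum_index N (remaining r j)"
abbreviation "s \<equiv> stage_time r j"
abbreviation "s' \<equiv> stage_time r (j + 1)"
abbreviation "x i t \<equiv> pos r (enum_index N (remaining r j) i) t"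
abbreviation "v i t \<equiv> dens r (enum_index N (remaining r j) i) t"
abbreviation "W i t \<equiv> particle_velocity f
  (dens r (enum_index N (remaining r j) (i - 1)) t) (dens r (enum_index N (remaining r j) i) t)"

definition mass :: "nat \<Rightarrow> real" where
  "mass i = (x (i + 1) s - x i s) * v i s"

lemma S_sub: "S \<subseteq> {1..N}" and N_in_S: "N \<in> S"
  using start by (auto simp: admissible_start_def)

lemma fin_S: "finite S" using S_sub finite_subset by blast

lemma n_ge_1: "1 \<le> n"
  using N_in_S fin_S by (metis One_nat_def Suc_leI card_gt_0_iff empty_iff)

lemma p_n: "p n = N" by (rule enum_index_card[OF S_sub N_in_S])

lemma p_in: "i \<in> {1..n} \<Longrightarrow> p i \<in> S"
  using enum_index_image[OF fin_S, of N] by blast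

lemma p_less: "1 \<le> i \<Longrightarrow> i < k \<Longrightarrow> k \<le> n \<Longrightarrow> p i < p k"
  using strict_mono_onD[OF strict_mono_on_enum_index[of S N], of i k] by auto

lemma s_less: "s < s'" and s'_le: "s' \<le> T"
  using stage by (auto simp: particle_stage_def Let_def)

lemma x_cont: "i \<in> {1..n} \<Longrightarrow> continuous_on {s..s'} (x i)"
  using stage by (simp add: particle_stage_def Let_def)

lemma x_deriv: "i \<in> {1..n} \<Longrightarrow> t \<in> {s<..<s'} \<Longrightarrow> (x i has_real_derivative W i t) (at t)"
  using stage by (simp add: particle_stage_def Let_def)

lemma W_cont:
  assumes i: "i \<in> {1..n}"
  shows "continuous_on {s<..<s'} (W i)"
proof -
  have "x i C1_differentiable_on {s<..<s'}"
    using stage i by (simp add: particle_stage_def Let_def)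
  then obtain D where D: "\<And>t. t \<in> {s<..<s'} \<Longrightarrow> (x i has_vector_derivative D t) (at t)"
    "continuous_on {s<..<s'} D"
    unfolding C1_differentiable_on_def by blast
  have eq: "D t = W i t" if "t \<in> {s<..<s'}" for t
    using D(1)[OF that] x_deriv[OF i that]
    by (meson DERIV_unique has_real_derivative_iff_has_vector_derivative)
  show ?thesis by (rule continuous_on_eq[OF D(2)]) (rule eq)
qed

lemma x_strict:
  assumes t: "t \<in> {s..<s'}" and "1 \<le> i" "i < k" "k \<le> n"
  shows "x i t < x k t"
proof (cases "t = s")
  case True
  have "strict_mono_on S (\<lambda>k. pos r k s)" using start by (simp add: admissible_start_def)
  then show ?thesis
    using strict_mono_onD[of S "\<lambda>k. pos r k s" "p i" "p k"] p_in[of i] p_in[of k] p_less[of i k]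
      assms True by auto
next
  case False
  have "\<forall>t\<in>{s<..<s'}. strict_mono_on {1..n} (\<lambda>i. x i t)"
    using stage by (simp add: particle_stage_def Let_def)
  then have "strict_mono_on {1..n} (\<lambda>i. x i t)" using t False by simp
  then show ?thesis
    using strict_mono_onD[of "{1..n}" "\<lambda>i. x i t" i k] assms by auto
qed

lemma gap_pos: "t \<in> {s..<s'} \<Longrightarrow> i \<in> {1..<n} \<Longrightarrow> 0 < x (i + 1) t - x i t"
  using x_strict[of t i "i + 1"] by simp

lemma dens_eq:
  assumes "t \<in> {s..<s'}" "i \<in> {1..<n}"
  shows "v i t = mass i / (x (i + 1) t - x i t)"
proof -
  have "v i t = (x (i + 1) s - x i s) / (x (i + 1) t - x i t) * v i s"
    using stage assms unfolding particle_stage_def Let_def by blast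
  then show ?thesis by (simp add: mass_def)
qed

lemma mass_eq:
  assumes "t \<in> {s..<s'}" "i \<in> {1..<n}"
  shows "v i t * (x (i + 1) t - x i t) = mass i"
  using dens_eq[OF assms] gap_pos[OF assms] by simp

lemma mass_nonneg:
  assumes "i \<in> {1..<n}"
  shows "0 \<le> mass i"
proof -
  have "0 \<le> v i s"
    using start p_in[of i] assms by (auto simp: admissible_start_def)
  then show ?thesis
    using gap_pos[of s i] s_less assms by (simp add: mass_def)
qed

lemma gap_cont: "i \<in> {1..<n} \<Longrightarrow> continuous_on {s..s'} (\<lambda>t. x (i + 1) t - x i t)"
  by (intro continuous_on_diff x_cont) auto

text \<open>A cell of maximal density does not shrink, so the maximum principle bounds every density
  by its largest initial value.\<close>

lemma density_bounded:
  obtains M where "\<And>i t. i \<in> {0..n} \<Longrightarrow> t \<in> {s..<s'} \<Longrightarrow> v i t \<le> M"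
proof -
  have edge: "v i t = 0" if "i = 0 \<or> i = n" for i t
    using that boundary p_n by auto
  define M where "M = Max ((\<lambda>i. v i s) ` {0..n})"
  have "v i t \<le> M" if i: "i \<in> {0..n}" and t: "t \<in> {s..<s'}" for i t
  proof (rule finite_family_maximum_principle[where I = "{0..n}" and s = s and u = t and w = v])
    show "finite {0..n}" by simp
    show "v k s \<le> M" if "k \<in> {0..n}" for k
      unfolding M_def using that by (intro Max_ge) auto
    show "continuous_on {s..t} (v k)" if k: "k \<in> {0..n}" for k
    proof (cases "k = 0 \<or> k = n")
      case True
      then have "v k = (\<lambda>_. 0)" using edge by blast
      then show ?thesis by simp
    next
      case False
      then have k': "k \<in> {1..<n}" using k by auto
      have "continuous_on {s..t} (\<lambda>\<tau>. x (k + 1) \<tau> - x k \<tau>)"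
        by (rule continuous_on_subset[OF gap_cont[OF k']]) (use t in auto)
      then have "continuous_on {s..t} (\<lambda>\<tau>. mass k / (x (k + 1) \<tau> - x k \<tau>))"
        using gap_pos[OF _ k'] t by (intro continuous_on_divide) force+
      then show ?thesis
        by (rule continuous_on_eq) (use dens_eq[OF _ k'] t in auto)
    qed
    show "\<exists>d\<le>0. (v k has_real_derivative d) (at \<tau>)"
      if k: "k \<in> {0..n}" and \<tau>: "s < \<tau>" "\<tau> \<le> t" and top: "\<forall>m\<in>{0..n}. v m \<tau> \<le> v k \<tau>" for k \<tau>
    proof (cases "k = 0 \<or> k = n")
      case True
      then have "v k = (\<lambda>_. 0)" using edge by blast
      then show ?thesis by (auto intro!: exI[of _ 0])
    next
      case False
      then have k': "k \<in> {1..<n}" using k by auto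
      have \<tau>': "\<tau> \<in> {s<..<s'}" using \<tau> t by auto
      let ?g = "\<lambda>\<tau>. x (k + 1) \<tau> - x k \<tau>"
      define d where "d = - (mass k * (W (k + 1) \<tau> - W k \<tau>)) / (?g \<tau>)\<^sup>2"
      have g: "?g \<tau> > 0" using gap_pos[OF _ k'] \<tau>' by simp
      have "(?g has_real_derivative W (k + 1) \<tau> - W k \<tau>) (at \<tau>)"
        using k' by (intro DERIV_diff x_deriv \<tau>') auto
      from DERIV_divide[OF DERIV_const this, of "mass k"]
      have "((\<lambda>\<tau>. mass k / ?g \<tau>) has_real_derivative d) (at \<tau>)"
        using g by (simp add: d_def power2_eq_square)
      then have "(v k has_real_derivative d) (at \<tau>)"
        by (rule DERIV_cong_ev[OF refl _ refl, THEN iffD1, rotated])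
           (rule eventually_nhds_in_open[THEN eventually_mono, of "{s<..<s'}"],
            use \<tau>' dens_eq[OF _ k'] in auto)
      moreover have "d \<le> 0"
      proof -
        have "W k \<tau> \<le> W (k + 1) \<tau>"
          using particle_velocity_le_at_local_max[OF lipschitz f_0 f_diff,
              of "v (k - 1) \<tau>" "v k \<tau>" "v (k + 1) \<tau>"] top k' by auto
        then show ?thesis
          using mass_nonneg[OF k'] unfolding d_def by (simp add: mult_nonneg_nonneg divide_nonpos_nonneg)
      qed
      ultimately show ?thesis by blast
    qed
  qed (use i t in auto)
  then show thesis by (rule that)
qed

lemma tendsto_end: "i \<in> {1..n} \<Longrightarrow> (x i \<longlongrightarrow> x i s') (at_left s')"
  using x_cont[of i] s_less by (simp add: continuous_on_Icc_at_leftD)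

lemma eventually_in_stage: "\<forall>\<^sub>F t in at_left s'. t \<in> {s..<s'}"
  using eventually_at_left_real[OF s_less] by (rule eventually_mono) auto

lemma gap_end_tendsto:
  "i \<in> {1..<n} \<Longrightarrow> ((\<lambda>t. x (i + 1) t - x i t) \<longlongrightarrow> x (i + 1) s' - x i s') (at_left s')"
  by (intro tendsto_diff tendsto_end) auto

lemma gap_end_nonneg:
  assumes "i \<in> {1..<n}"
  shows "x i s' \<le> x (i + 1) s'"
proof -
  have "0 \<le> x (i + 1) s' - x i s'"
    by (rule tendsto_lowerbound[OF gap_end_tendsto[OF assms]])
       (use eventually_in_stage gap_pos[OF _ assms] in \<open>auto elim!: eventually_mono simp: less_imp_le\<close>)
  then show ?thesis by simp
qed

text \<open>Only empty cells collapse, because a positive mass in a vanishing cell would have unbounded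
  density. Hence the deletions at the end of a stage lose no mass.\<close>

lemma collapse_mass_zero:
  assumes i: "i \<in> {1..<n}" and eq: "x i s' = x (i + 1) s'"
  shows "mass i = 0"
proof -
  obtain M where M: "\<And>i t. i \<in> {0..n} \<Longrightarrow> t \<in> {s..<s'} \<Longrightarrow> v i t \<le> M"
    using density_bounded by blast
  have "((\<lambda>t. M * (x (i + 1) t - x i t)) \<longlongrightarrow> M * (x (i + 1) s' - x i s')) (at_left s')"
    by (intro tendsto_mult_left gap_end_tendsto i)
  moreover have "\<forall>\<^sub>F t in at_left s'. mass i \<le> M * (x (i + 1) t - x i t)"
    using eventually_in_stage
  proof (rule eventually_mono)
    fix t assume t: "t \<in> {s..<s'}"
    show "mass i \<le> M * (x (i + 1) t - x i t)"
      unfolding mass_eq[OF t i, symmetric]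
      using M[of i t] gap_pos[OF t i] t i by (intro mult_right_mono) auto
  qed
  ultimately have "mass i \<le> M * (x (i + 1) s' - x i s')"
    by (intro tendsto_lowerbound) auto
  then show ?thesis using eq mass_nonneg[OF i] by simp
qed

text \<open>The last particle always survives, because its right neighbour sits at \<open>\<infinity>\<close>.\<close>

lemma survivors: "S' = {p i | i. i \<in> {1..n} \<and> (i = n \<or> x i s' \<noteq> x (i + 1) s')}"
proof -
  have inner: "p i \<noteq> 0 \<and> p i \<noteq> N + 1" if "i \<in> {1..n}" for i
    using p_in[OF that] S_sub by auto
  have last: "p (n + 1) = N + 1" by (simp add: enum_index_def)
  have "extended_pos N (\<lambda>k. pos r k s') (p i) \<noteq> extended_pos N (\<lambda>k. pos r k s') (p (i + 1))
      \<longleftrightarrow> i = n \<or> x i s' \<noteq> x (i + 1) s'" if "i \<in> {1..n}" for i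
    using inner[OF that] inner[of "i + 1"] last that
    by (cases "i = n") (auto simp: extended_pos_def)
  moreover have "S' = {p i | i. i \<in> {1..n} \<and>
      extended_pos N (\<lambda>k. pos r k s') (p i) \<noteq> extended_pos N (\<lambda>k. pos r k s') (p (i + 1))}"
    using stage by (simp add: particle_stage_def Let_def)
  ultimately show ?thesis by blast
qed

lemma survivorE:
  assumes "k \<in> S'"
  obtains i where "i \<in> {1..n}" "k = p i" "i = n \<or> x i s' \<noteq> x (i + 1) s'"
  using assms unfolding survivors by blast

lemma survivorI: "i \<in> {1..n} \<Longrightarrow> i = n \<or> x i s' \<noteq> x (i + 1) s' \<Longrightarrow> p i \<in> S'"
  unfolding survivors by blast

lemma S'_sub: "S' \<subseteq> S" using p_in by (blast elim: survivorE)

lemma fin_S': "finite S'" using S'_sub fin_S finite_subset by blast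

lemma N_in_S': "N \<in> S'" using survivorI[of n] p_n n_ge_1 by simp

lemma survivor_gap:
  assumes i: "i \<in> {1..<n}" and "p i \<in> S'"
  shows "x i s' < x (i + 1) s'"
proof -
  obtain k where k: "k \<in> {1..n}" "p i = p k" "k = n \<or> x k s' \<noteq> x (k + 1) s'"
    using assms(2) by (rule survivorE)
  have "i = k"
    using p_less[of i k] p_less[of k i] k i by (cases i k rule: linorder_cases) auto
  then show ?thesis using k i gap_end_nonneg[OF i] by auto
qed

lemma deleted_gap:
  assumes i: "i \<in> {1..<n}" and "p i \<notin> S'"
  shows "x i s' = x (i + 1) s'"
  using assms survivorI[of i] by auto

lemma end_mono:
  assumes "1 \<le> i" "i \<le> k" "k \<le> n"
  shows "x i s' \<le> x k s'"
  using assms(2,3)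
proof (induction k rule: dec_induct)
  case (step m)
  then show ?case using gap_end_nonneg[of m] assms(1) by simp
qed simp

text \<open>Between a survivor and the next survivor all particles have met, so the right end of a
  surviving cell does not jump.\<close>

lemma successor_end_pos:
  assumes i: "i \<in> {1..<n}" and surv: "p i \<in> S'"
  shows "pos r (successor_in S' (p i)) s' = x (i + 1) s'"
proof -
  have ne: "{l \<in> S'. p i < l} \<noteq> {}"
    using N_in_S' p_less[of i n] i p_n by auto
  have "successor_in S' (p i) \<in> {l \<in> S'. p i < l}"
    unfolding successor_in_def using fin_S' ne by (intro Min_in) auto
  then have succ: "successor_in S' (p i) \<in> S'" "p i < successor_in S' (p i)" by auto
  have min: "successor_in S' (p i) \<le> l" if "l \<in> S'" "p i < l" for l
    unfolding successor_in_def using fin_S' that by (intro Min_le) auto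
  obtain m where m: "m \<in> {1..n}" "successor_in S' (p i) = p m"
    using succ(1) by (rule survivorE)
  then have pm: "p i < p m" using succ(2) by simp
  have im: "i + 1 \<le> m"
    using m pm i p_less[of m i] by (cases m i rule: linorder_cases) auto
  have "x k s' = x (i + 1) s'" if "i + 1 \<le> k" "k \<le> m" for k
    using that
  proof (induction k rule: dec_induct)
    case (step k)
    have "p k \<notin> S'"
    proof
      assume "p k \<in> S'"
      moreover have "p i < p k" "p k < p m"
        using p_less[of i k] p_less[of k m] m(1) step i by auto
      ultimately show False using min[of "p k"] m(2) by simp
    qed
    then show ?case using deleted_gap[of k] step m by simp
  qed simp
  from this[OF im order_refl] show ?thesis unfolding m(2) .
qed

lemma end_mass:
  assumes i: "i \<in> {1..<n}" and surv: "p i \<in> S'"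
  shows "v i s' * (x (i + 1) s' - x i s') = mass i"
proof -
  have g: "x (i + 1) s' - x i s' \<noteq> 0" using survivor_gap[OF assms] by simp
  have "(dens r (p i) \<longlongrightarrow> dens r (p i) s') (at_left s')"
    using stage surv by (simp add: particle_stage_def Let_def)
  moreover have "(dens r (p i) \<longlongrightarrow> mass i / (x (i + 1) s' - x i s')) (at_left s')"
    by (rule Lim_transform_eventually[OF tendsto_divide[OF tendsto_const gap_end_tendsto[OF i] g]])
       (use eventually_in_stage dens_eq[OF _ i] in \<open>auto elim!: eventually_mono\<close>)
  ultimately have "v i s' = mass i / (x (i + 1) s' - x i s')"
    by (intro tendsto_unique) auto
  then show ?thesis using g by simp
qed

lemma admissible_end: "admissible_start N r (j + 1)"
  unfolding admissible_start_def
proof (intro conjI ballI)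
  show "S' \<subseteq> {1..N}" using S'_sub S_sub by blast
  show "N \<in> S'" by (rule N_in_S')
  show "strict_mono_on S' (\<lambda>k. pos r k s')"
  proof (rule strict_mono_onI)
    fix a b assume ab: "a \<in> S'" "b \<in> S'" "a < b"
    then obtain i k where ik: "i \<in> {1..n}" "a = p i" "k \<in> {1..n}" "b = p k"
      by (meson survivorE)
    have "i < k" using ik ab(3) p_less[of k i] by (cases i k rule: linorder_cases) auto
    then show "pos r a s' < pos r b s'"
      using survivor_gap[of i] end_mono[of "i + 1" k] ab ik by force
  qed
  fix k assume k: "k \<in> S'"
  then obtain i where i: "i \<in> {1..n}" "k = p i" by (meson survivorE)
  show "0 \<le> dens r k s'"
  proof (cases "i = n")
    case True
    then show ?thesis using i p_n boundary by simp
  next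
    case False
    then have i': "i \<in> {1..<n}" using i by auto
    show ?thesis
      using end_mass[OF i'] mass_nonneg[OF i'] survivor_gap[OF i'] k i
      by (metis diff_gt_0_iff_gt mult_neg_pos not_le)
  qed
qed

text \<open>With constant masses this function is continuous on the closed time interval of the stage,
  although the densities of cells that collapse have no prescribed value at its end.\<close>

definition flow :: "(real \<times> real \<Rightarrow> real) \<Rightarrow> real \<Rightarrow> real" where
  "flow \<psi> t = (\<Sum>i\<in>{1..<n}. mass i * cell_mean \<psi> (x i t) (x (i + 1) t) t)"

lemma weighted_mass_stage:
  assumes t: "t \<in> {s..<s'}"
  shows "weighted_mass \<psi> N r S t = flow \<psi> t"
  unfolding weighted_mass_def sum_over_cells[OF S_sub N_in_S, symmetric,
      where h = "\<lambda>k l. dens r k t * (pos r l t - pos r k t) * cell_mean \<psi> (pos r k t) (pos r l t) t"]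
    flow_def
  by (intro sum.cong refl) (simp only: mass_eq[OF t])

text \<open>Surviving cells keep their end points and their mass, and the terms of deleted cells vanish
  with their mass.\<close>

lemma weighted_mass_end: "weighted_mass \<psi> N r S' s' = flow \<psi> s'"
proof -
  define c where "c k l = cell_mean \<psi> (pos r k s') (pos r l s') s'" for k l
  have "flow \<psi> s' = (\<Sum>i\<in>{1..<n}. mass i * c (p i) (p (i + 1)))"
    by (simp add: flow_def c_def)
  also have "\<dots> = (\<Sum>i\<in>{1..<n}. if p i \<in> S' then
      dens r (p i) s' * (pos r (successor_in S' (p i)) s' - pos r (p i) s')
        * c (p i) (successor_in S' (p i)) else 0)"
  proof (rule sum.cong[OF refl])
    fix i assume i: "i \<in> {1..<n}"
    show "mass i * c (p i) (p (i + 1)) = (if p i \<in> S' then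
      dens r (p i) s' * (pos r (successor_in S' (p i)) s' - pos r (p i) s')
        * c (p i) (successor_in S' (p i)) else 0)"
    proof (cases "p i \<in> S'")
      case True
      then show ?thesis
        using end_mass[OF i True] successor_end_pos[OF i True] by (simp add: c_def)
    next
      case False
      then show ?thesis
        using collapse_mass_zero[OF i deleted_gap[OF i False]] by simp
    qed
  qed
  also have "\<dots> = (\<Sum>k\<in>S - {N}. if k \<in> S' then
      dens r k s' * (pos r (successor_in S' k) s' - pos r k s') * c k (successor_in S' k) else 0)"
    by (rule sum.reindex_bij_betw[OF bij_betw_enum_index[OF S_sub N_in_S]])
  also have "\<dots> = (\<Sum>k\<in>(S - {N}) \<inter> S'.
      dens r k s' * (pos r (successor_in S' k) s' - pos r k s') * c k (successor_in S' k))"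
    using fin_S by (intro sum.inter_restrict[symmetric]) auto
  also have "(S - {N}) \<inter> S' = S' - {N}" using S'_sub by blast
  finally show ?thesis by (simp add: weighted_mass_def c_def)
qed

text \<open>Density times width is the mass of a cell. The family \<open>g\<close> allows for integrands such as
  the velocity field, whose formula changes from cell to cell, and makes continuity a matter of
  the individual closed cells.\<close>

lemma integral_against_approx:
  fixes g :: "nat \<Rightarrow> real \<Rightarrow> real" and h :: "real \<Rightarrow> real"
  assumes t: "t \<in> {s..<s'}"
    and g: "\<And>i. i \<in> {1..<n} \<Longrightarrow> continuous_on {x i t..x (i + 1) t} (g i)"
    and h: "\<And>i y. i \<in> {1..<n} \<Longrightarrow> y \<in> {x i t<..<x (i + 1) t} \<Longrightarrow> h y = g i y"
  shows "(LINT y|lebesgue. h y * particle_approx N r y t)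
     = (\<Sum>i\<in>{1..<n}. mass i * integral {0..1} (\<lambda>\<theta>. g i (x i t + \<theta> * (x (i + 1) t - x i t))))"
proof -
  have sat: "stage_at r t = j" using stage_at t by auto
  let ?X = "extended_pos N (\<lambda>k. pos r k t)"
  have X: "?X (p i) = ereal (x i t)" if "i \<in> {1..n}" for i
    using p_in[OF that] S_sub by (auto simp: extended_pos_def)
  have approx: "particle_approx N r y t
      = (\<Sum>i\<in>{1..<n}. v i t * indicator {x i t<..<x (i + 1) t} y)" for y
  proof -
    have "particle_approx N r y t
        = (\<Sum>i=0..n. v i t * indicator {?X (p i)<..<?X (p (i + 1))} (ereal y))"
      by (simp add: particle_approx_def Let_def sat)
    also have "\<dots> = (\<Sum>i\<in>{1..<n}. v i t * indicator {?X (p i)<..<?X (p (i + 1))} (ereal y))"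
    proof (rule sum.mono_neutral_right)
      show "\<forall>i\<in>{0..n} - {1..<n}. v i t * indicator {?X (p i)<..<?X (p (i + 1))} (ereal y) = 0"
      proof
        fix i assume "i \<in> {0..n} - {1..<n}"
        then have "i = 0 \<or> i = n" by auto
        then have "v i t = 0" using boundary p_n by auto
        then show "v i t * indicator {?X (p i)<..<?X (p (i + 1))} (ereal y) = 0" by simp
      qed
    qed auto
    also have "\<dots> = (\<Sum>i\<in>{1..<n}. v i t * indicator {x i t<..<x (i + 1) t} y)"
      by (intro sum.cong refl) (auto simp: X indicator_def)
    finally show ?thesis .
  qed
  have cell: "integrable lebesgue (\<lambda>y. h y * indicator {x i t<..<x (i + 1) t} y)"
    "(LINT y|lebesgue. h y * indicator {x i t<..<x (i + 1) t} y)
       = (x (i + 1) t - x i t) * integral {0..1} (\<lambda>\<theta>. g i (x i t + \<theta> * (x (i + 1) t - x i t)))"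
    if i: "i \<in> {1..<n}" for i
    by (rule cell_integral_eq(1)[OF _ g[OF i] h[OF i]] cell_integral_eq(2)[OF _ g[OF i] h[OF i]],
        use gap_pos[OF t i] in simp, assumption)+
  have "h y * particle_approx N r y t
      = (\<Sum>i\<in>{1..<n}. v i t * (h y * indicator {x i t<..<x (i + 1) t} y))" for y
    unfolding approx sum_distrib_left by (intro sum.cong refl) (rule mult.left_commute)
  then have "(LINT y|lebesgue. h y * particle_approx N r y t)
      = (LINT y|lebesgue. (\<Sum>i\<in>{1..<n}. v i t * (h y * indicator {x i t<..<x (i + 1) t} y)))"
    by (simp only:)
  also have "\<dots> = (\<Sum>i\<in>{1..<n}. v i t * (LINT y|lebesgue. h y * indicator {x i t<..<x (i + 1) t} y))"
    using cell(1) by (simp only: Bochner_Integration.integral_sum integrable_mult_right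
        integral_mult_right_zero)
  also have "\<dots> = (\<Sum>i\<in>{1..<n}. mass i * integral {0..1} (\<lambda>\<theta>. g i (x i t + \<theta> * (x (i + 1) t - x i t))))"
    by (intro sum.cong refl) (simp only: cell(2) mass_eq[OF t, symmetric] mult.assoc)
  finally show ?thesis .
qed

lemma velocity_field_in_cell:
  assumes t: "t \<in> {s..<s'}" and i: "i \<in> {1..<n}" and y: "y \<in> {x i t<..<x (i + 1) t}"
  shows "velocity_field f N r y t =
     (x (i + 1) t - y) / (x (i + 1) t - x i t) * W i t
     + (y - x i t) / (x (i + 1) t - x i t) * W (i + 1) t"
proof -
  have sat: "stage_at r t = j" using stage_at t by auto
  have le: "x a t \<le> x b t" if "1 \<le> a" "a \<le> b" "b \<le> n" for a b
    using x_strict[OF t, of a b] that by (cases "a = b") auto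
  have "\<not> y \<le> x 1 t" "\<not> x n t \<le> y"
    using le[of 1 i] le[of "i + 1" n] i y by auto
  moreover have "Max {k. 1 \<le> k \<and> k \<le> n \<and> x k t \<le> y} = i"
  proof (rule Max_eqI)
    fix k assume k: "k \<in> {k. 1 \<le> k \<and> k \<le> n \<and> x k t \<le> y}"
    show "k \<le> i"
    proof (rule ccontr)
      assume "\<not> k \<le> i"
      then show False using le[of "i + 1" k] k y by auto
    qed
  qed (use i y in auto)
  ultimately show ?thesis
    by (simp add: velocity_field_def Let_def sat)
qed

end

section \<open>Integrating over one stage\<close>

definition weak_integrand ::
  "(real \<Rightarrow> real) \<Rightarrow> nat \<Rightarrow> particle_run \<Rightarrow> (real \<times> real \<Rightarrow> real) \<Rightarrow> real \<Rightarrow> real" where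
  "weak_integrand f N r \<phi> t = (LINT x|lebesgue.
     (deriv (\<lambda>s. \<phi> (x, s)) t + velocity_field f N r x t * deriv (\<lambda>y. \<phi> (y, t)) x)
       * particle_approx N r x t)"

text \<open>The fundamental theorem by itself yields a gauge integral; boundedness of the derivative
  turns it into a Lebesgue integral.\<close>

lemma integral_of_bounded_derivative:
  fixes F G :: "real \<Rightarrow> real"
  assumes "a \<le> b" and "continuous_on {a..b} G"
    and deriv: "\<And>t. t \<in> {a<..<b} \<Longrightarrow> (G has_real_derivative F t) (at t)"
    and bound: "\<And>t. t \<in> {a<..<b} \<Longrightarrow> \<bar>F t\<bar> \<le> B"
  shows "(F has_integral G b - G a) {a..b}" and "F absolutely_integrable_on {a..b}"
proof -
  show int: "(F has_integral G b - G a) {a..b}"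
    by (rule fundamental_theorem_of_calculus_interior[OF assms(1,2)])
       (simp add: deriv has_real_derivative_iff_has_vector_derivative[symmetric])
  show "F absolutely_integrable_on {a..b}"
  proof (rule absolutely_integrable_integrable_bound)
    \<comment> \<open>Nothing is known about \<open>F\<close> at the end points, so the majorant follows \<open>F\<close> there.\<close>
    show "norm (F t) \<le> (if t \<in> {a, b} then \<bar>F t\<bar> else B)" if "t \<in> {a..b}" for t
      using bound[of t] that by auto
    show "F integrable_on {a..b}" using int by blast
    show "(\<lambda>t. if t \<in> {a, b} then \<bar>F t\<bar> else B) integrable_on {a..b}"
      by (rule integrable_spike_finite[of "{a, b}" _ _ "\<lambda>_. B"]) auto
  qed
qed

locale tested_stage = scheme_stage f L T N r j + extended_test_function T \<phi> \<psi> \<phi>x \<phi>t C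
  for f :: "real \<Rightarrow> real" and L T :: real and N :: nat and r :: particle_run and j :: nat
    and \<phi> \<psi> \<phi>x \<phi>t :: "real \<times> real \<Rightarrow> real" and C :: real
begin

definition flow_rate :: "real \<Rightarrow> real" where
  "flow_rate t = (\<Sum>i\<in>{1..<n}. mass i * integral {0..1} (\<lambda>\<theta>.
     \<phi>t (x i t + \<theta> * (x (i + 1) t - x i t), t)
     + ((1 - \<theta>) * W i t + \<theta> * W (i + 1) t) * \<phi>x (x i t + \<theta> * (x (i + 1) t - x i t), t)))"

lemma stage_sub: "{s<..<s'} \<subseteq> {0<..<T}" "{s..s'} \<subseteq> {0..T}"
  using time_nonneg s'_le by auto

lemma flow_cont: "continuous_on {s..s'} (flow \<psi>)"
  unfolding flow_def
proof (intro continuous_on_sum continuous_on_mult_left continuous_on_cell_mean)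
  show "continuous_on (UNIV \<times> {s..s'}) \<psi>"
    by (rule continuous_on_subset[OF \<psi>_cont]) (use stage_sub in auto)
qed (rule x_cont, simp)+

lemma flow_deriv:
  assumes t: "t \<in> {s<..<s'}"
  shows "(flow \<psi> has_real_derivative flow_rate t) (at t)"
  unfolding flow_def[abs_def] flow_rate_def
proof (rule DERIV_sum, rule DERIV_cmult)
  have sub: "UNIV \<times> {s<..<s'} \<subseteq> UNIV \<times> {0<..<T}" using stage_sub by blast
  fix i assume i: "i \<in> {1..<n}"
  show "((\<lambda>t. cell_mean \<psi> (x i t) (x (i + 1) t) t) has_real_derivative
      integral {0..1} (\<lambda>\<theta>. \<phi>t (x i t + \<theta> * (x (i + 1) t - x i t), t)
       + ((1 - \<theta>) * W i t + \<theta> * W (i + 1) t) * \<phi>x (x i t + \<theta> * (x (i + 1) t - x i t), t))) (at t)"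
  proof (rule cell_mean_has_derivative[where J = "{s<..<s'}"])
    show "(\<psi> has_derivative (\<lambda>h. fst h * \<phi>x z + snd h * \<phi>t z)) (at z)"
      if "z \<in> UNIV \<times> {s<..<s'}" for z
      using \<psi>_deriv that sub by blast
    show "continuous_on (UNIV \<times> {s<..<s'}) \<phi>x" "continuous_on (UNIV \<times> {s<..<s'}) \<phi>t"
      using continuous_on_subset[OF \<phi>x_cont sub] continuous_on_subset[OF \<phi>t_cont sub] by auto
    show "(x i has_real_derivative W i \<tau>) (at \<tau>)"
      "(x (i + 1) has_real_derivative W (i + 1) \<tau>) (at \<tau>)" if "\<tau> \<in> {s<..<s'}" for \<tau>
      by (rule x_deriv[OF _ that]; use i in simp)+
    show "continuous_on {s<..<s'} (W i)" "continuous_on {s<..<s'} (W (i + 1))"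
      by (rule W_cont; use i in simp)+
  qed (use t in auto)
qed

lemma slice_cont:
  assumes "continuous_on (UNIV \<times> J) g" "t \<in> J"
  shows "continuous_on A (\<lambda>y. g (y, t))"
  by (rule continuous_on_compose2[OF assms(1)]) (use assms(2) in \<open>auto intro!: continuous_intros\<close>)

lemma flow_rate_bound:
  assumes t: "t \<in> {s<..<s'}"
  shows "\<bar>flow_rate t\<bar> \<le> (\<Sum>i\<in>{1..<n}. mass i * (C + L * C))"
  unfolding flow_rate_def
proof (rule order_trans[OF sum_abs sum_mono])
  have t': "t \<in> {0<..<T}" using t stage_sub by blast
  have slice: "continuous_on {0..1} (\<lambda>\<theta>. g (a + \<theta> * b, t))"
    if "continuous_on (UNIV \<times> {0<..<T}) g" for g :: "real \<times> real \<Rightarrow> real" and a b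
    by (rule continuous_on_compose2[OF slice_cont[OF that t', of UNIV]])
       (auto intro!: continuous_intros)
  fix i assume i: "i \<in> {1..<n}"
  have "\<bar>integral {0..1} (\<lambda>\<theta>. \<phi>t (x i t + \<theta> * (x (i + 1) t - x i t), t)
      + ((1 - \<theta>) * W i t + \<theta> * W (i + 1) t) * \<phi>x (x i t + \<theta> * (x (i + 1) t - x i t), t))\<bar> \<le> C + L * C"
    using t' by (intro abs_integral_material_derivative_le slice \<phi>x_cont \<phi>t_cont \<phi>x_bound \<phi>t_bound
        abs_particle_velocity_le lipschitz f_0 f_diff) auto
  then show "\<bar>mass i * integral {0..1} (\<lambda>\<theta>. \<phi>t (x i t + \<theta> * (x (i + 1) t - x i t), t)
      + ((1 - \<theta>) * W i t + \<theta> * W (i + 1) t) * \<phi>x (x i t + \<theta> * (x (i + 1) t - x i t), t))\<bar>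
    \<le> mass i * (C + L * C)"
    unfolding abs_mult using mass_nonneg[OF i] by (simp add: mult_left_mono)
qed

lemma weak_integrand_eq:
  assumes t: "t \<in> {s<..<s'}"
  shows "weak_integrand f N r \<phi> t = flow_rate t"
proof -
  have t': "t \<in> {0<..<T}" "t \<in> {s..<s'}" using t stage_sub by auto
  define g where "g i y = \<phi>t (y, t) + ((x (i + 1) t - y) / (x (i + 1) t - x i t) * W i t
     + (y - x i t) / (x (i + 1) t - x i t) * W (i + 1) t) * \<phi>x (y, t)" for i y
  have "weak_integrand f N r \<phi> t
      = (\<Sum>i\<in>{1..<n}. mass i * integral {0..1} (\<lambda>\<theta>. g i (x i t + \<theta> * (x (i + 1) t - x i t))))"
    unfolding weak_integrand_def
  proof (rule integral_against_approx[OF t'(2)])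
    fix i assume i: "i \<in> {1..<n}"
    show "continuous_on {x i t..x (i + 1) t} (g i)"
      unfolding g_def using gap_pos[OF t'(2) i]
      by (intro continuous_intros slice_cont[OF \<phi>x_cont t'(1)] slice_cont[OF \<phi>t_cont t'(1)]) auto
    show "deriv (\<lambda>s. \<phi> (y, s)) t + velocity_field f N r y t * deriv (\<lambda>y. \<phi> (y, t)) y = g i y"
      if "y \<in> {x i t<..<x (i + 1) t}" for y
      unfolding g_def velocity_field_in_cell[OF t'(2) i that] deriv_space[OF t'(1)] deriv_time[OF t'(1)]
      by (rule refl)
  qed
  also have "\<dots> = flow_rate t"
    unfolding flow_rate_def
  proof (intro sum.cong refl arg_cong2[where f = "(*)"] integral_cong)
    fix i \<theta> assume i: "i \<in> {1..<n}"
    let ?d = "x (i + 1) t - x i t"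
    have d: "?d \<noteq> 0" using gap_pos[OF t'(2) i] by simp
    have "x (i + 1) t - (x i t + \<theta> * ?d) = (1 - \<theta>) * ?d" by (simp add: algebra_simps)
    then have "(x (i + 1) t - (x i t + \<theta> * ?d)) / ?d = 1 - \<theta>" "(x i t + \<theta> * ?d - x i t) / ?d = \<theta>"
      using d by simp_all
    then show "g i (x i t + \<theta> * ?d)
        = \<phi>t (x i t + \<theta> * ?d, t) + ((1 - \<theta>) * W i t + \<theta> * W (i + 1) t) * \<phi>x (x i t + \<theta> * ?d, t)"
      unfolding g_def by (simp only:)
  qed
  finally show ?thesis .
qed

lemma stage_integral:
  "(weak_integrand f N r \<phi> has_integral
      weighted_mass \<psi> N r S' s' - weighted_mass \<psi> N r S s) {s..s'}"
  "weak_integrand f N r \<phi> absolutely_integrable_on {s..s'}"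
proof -
  have deriv: "(flow \<psi> has_real_derivative weak_integrand f N r \<phi> t) (at t)"
    if "t \<in> {s<..<s'}" for t
    using flow_deriv[OF that] weak_integrand_eq[OF that] by simp
  have bound: "\<bar>weak_integrand f N r \<phi> t\<bar> \<le> (\<Sum>i\<in>{1..<n}. mass i * (C + L * C))"
    if "t \<in> {s<..<s'}" for t
    using flow_rate_bound[OF that] weak_integrand_eq[OF that] by simp
  have start_eq: "weighted_mass \<psi> N r S s = flow \<psi> s"
    using weighted_mass_stage s_less by simp
  show "(weak_integrand f N r \<phi> has_integral
      weighted_mass \<psi> N r S' s' - weighted_mass \<psi> N r S s) {s..s'}"
    unfolding weighted_mass_end start_eq
    by (rule integral_of_bounded_derivative(1)[OF less_imp_le[OF s_less] flow_cont deriv bound])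
  show "weak_integrand f N r \<phi> absolutely_integrable_on {s..s'}"
    by (rule integral_of_bounded_derivative(2)[OF less_imp_le[OF s_less] flow_cont deriv bound])
qed

lemma weighted_mass_start:
  "weighted_mass \<psi> N r S s = (LINT y|lebesgue. \<phi> (y, s) * particle_approx N r y s)"
proof -
  have t: "s \<in> {s..<s'}" "s \<in> {0..<T}" "s \<in> {0..T}"
    using s_less s'_le time_nonneg by auto
  have "(LINT y|lebesgue. \<phi> (y, s) * particle_approx N r y s)
     = (\<Sum>i\<in>{1..<n}. mass i * integral {0..1} (\<lambda>\<theta>. \<psi> (x i s + \<theta> * (x (i + 1) s - x i s), s)))"
    by (rule integral_against_approx[OF t(1), where g = "\<lambda>i y. \<psi> (y, s)"])
       (use \<psi>_eq[OF t(2)] slice_cont[OF \<psi>_cont t(3)] in auto)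
  then show ?thesis
    unfolding weighted_mass_stage[OF t(1)] flow_def cell_mean_def by simp
qed

end

section \<open>Summation over the stages\<close>

lemma stage_time_less:
  assumes "particle_path_scheme f u0 T N x0 r" and "i < k" and "k \<le> num_stages r"
  shows "stage_time r i < stage_time r k"
  using assms(2,3)
proof (induction k)
  case (Suc k)
  have "stage_time r k < stage_time r (Suc k)"
    using assms(1) Suc.prems(2) by (auto simp: particle_path_scheme_def particle_stage_def Let_def)
  then show ?case using Suc by (cases "i = k") auto
qed simp

lemma stage_at_eq:
  assumes run: "particle_path_scheme f u0 T N x0 r" and "j < num_stages r"
    and t: "stage_time r j \<le> t" "t < stage_time r (j + 1)"
  shows "stage_at r t = j"
  unfolding stage_at_def
proof (rule Max_eqI)
  show "finite {j. j \<le> num_stages r \<and> stage_time r j \<le> t}" by simp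
  show "j \<in> {j. j \<le> num_stages r \<and> stage_time r j \<le> t}" using assms by simp
  fix k assume k: "k \<in> {j. j \<le> num_stages r \<and> stage_time r j \<le> t}"
  show "k \<le> j"
  proof (rule ccontr)
    assume "\<not> k \<le> j"
    then have "stage_time r (j + 1) \<le> stage_time r k"
      using stage_time_less[OF run, of "j + 1" k] k by (cases "k = j + 1") auto
    then show False using k t by simp
  qed
qed

lemma initial_dens_nonneg:
  assumes "AE y in lebesgue. u0 y \<ge> 0" and "strict_mono_on {1..N} x0"
  shows "0 \<le> initial_dens u0 N x0 i"
proof (cases "1 \<le> i \<and> i + 1 \<le> N")
  case True
  then have "x0 i < x0 (i + 1)" using strict_mono_onD[OF assms(2), of i "i + 1"] by auto
  moreover have "0 \<le> (LINT y:{x0 i..x0 (i + 1)}|lebesgue. u0 y)"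
    unfolding set_lebesgue_integral_def
    by (rule integral_nonneg_AE) (use assms(1) in \<open>auto elim!: eventually_mono simp: indicator_def\<close>)
  ultimately show ?thesis using True by (simp add: initial_dens_def)
qed (auto simp: initial_dens_def)

lemma admissible_start_0:
  assumes run: "particle_path_scheme f u0 T N x0 r" and "N \<ge> 1"
    and "AE y in lebesgue. u0 y \<ge> 0" and mono: "strict_mono_on {1..N} x0"
  shows "admissible_start N r 0"
proof -
  have "strict_mono_on {1..N} (\<lambda>k. pos r k 0)"
    using run mono unfolding particle_path_scheme_def strict_mono_on_def by auto
  then show ?thesis
    using run assms(2) initial_dens_nonneg[OF assms(3) mono]
    by (auto simp: admissible_start_def particle_path_scheme_def)
qed

text \<open>Initially no particle is missing, so the enumeration of the remaining indices is the
  identity.\<close>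

lemma initial_approx_eq:
  assumes run: "particle_path_scheme f u0 T N x0 r" and "T > 0" and "N \<ge> 1"
  shows "initial_approx u0 N x0 y = particle_approx N r y 0"
proof -
  have num: "0 < num_stages r"
    using run assms(2) by (cases "num_stages r") (auto simp: particle_path_scheme_def)
  have "stage_time r 0 = 0" using run by (simp add: particle_path_scheme_def)
  then have sat: "stage_at r 0 = 0"
    using stage_at_eq[OF run num, of 0] stage_time_less[OF run, of 0 1] num by simp
  have rem: "remaining r 0 = {1..N}" using run by (simp add: particle_path_scheme_def)
  have enum: "enum_index N {1..N} i = i" if "i \<le> N + 1" for i
  proof -
    have "sorted_list_of_set {1..N} = [1..<Suc N]"
      by (metis atLeastLessThanSuc_atLeastAtMost sorted_list_of_set_range)
    then show ?thesis using that by (auto simp: enum_index_def simp del: upt_Suc)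
  qed
  have pos: "extended_pos N x0 i = extended_pos N (\<lambda>k. pos r k 0) i" if "i \<le> N + 1" for i
    using run that by (auto simp: extended_pos_def particle_path_scheme_def)
  have dens: "initial_dens u0 N x0 i = dens r i 0" if "i \<le> N" for i
    using run that by (auto simp: particle_path_scheme_def)
  show ?thesis
    unfolding initial_approx_def particle_approx_def Let_def sat rem card_atLeastAtMost
    by (rule sum.cong) (auto simp: enum[unfolded One_nat_def] pos dens)
qed

text \<open>At the final time the extended test function vanishes, so the telescoping sum of the stage
  contributions leaves only the initial term.\<close>

theorem proposition5p1:
  fixes f u0 :: "real \<Rightarrow> real" and T :: real and N :: nat and x0 :: "nat \<Rightarrow> real"
    and r :: particle_run and \<phi> :: "real \<times> real \<Rightarrow> real"
  assumes "T > 0"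
    and "\<exists>L. L-lipschitz_on UNIV f" and "f 0 = 0" and "f differentiable (at 0)"
    and "bounded_variation u0" and "integrable lebesgue u0" and "AE y in lebesgue. u0 y \<ge> 0"
    and "N \<ge> 1" and "strict_mono_on {1..N} x0"
    and "particle_path_scheme f u0 T N x0 r"
    and "\<phi> \<in> test_functions T"
  shows "(LINT t:{0..T}|lebesgue. (LINT x|lebesgue.
            (deriv (\<lambda>s. \<phi> (x, s)) t + velocity_field f N r x t * deriv (\<lambda>y. \<phi> (y, t)) x)
              * particle_approx N r x t))
         + (LINT x|lebesgue. \<phi> (x, 0) * initial_approx u0 N x0 x) = 0"
proof -
  note run = assms(10)
  obtain L where L: "L-lipschitz_on UNIV f" using assms(2) by blast
  obtain \<psi> \<phi>x \<phi>t C where ext: "extended_test_function T \<phi> \<psi> \<phi>x \<phi>t C"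
    using test_function_extension[OF assms(11)] by blast
  let ?F = "weak_integrand f N r \<phi>"
  let ?m = "\<lambda>j. weighted_mass \<psi> N r (remaining r j) (stage_time r j)"
  have t_0: "stage_time r 0 = 0" and t_final: "stage_time r (num_stages r) = T"
    using run by (simp_all add: particle_path_scheme_def)
  have nonneg: "0 \<le> stage_time r j" if "j \<le> num_stages r" for j
    using stage_time_less[OF run _ that, of 0] t_0 by (cases "j = 0") auto
  have stage: "tested_stage f L T N r j \<phi> \<psi> \<phi>x \<phi>t C"
    if "j < num_stages r" "admissible_start N r j" for j
    using L assms(3,4) ext that nonneg[of j] stage_at_eq[OF run that(1)] run
    by (intro tested_stage.intro scheme_stage.intro) (auto simp: particle_path_scheme_def)
  have "admissible_start N r j \<and> (?F has_integral ?m j - ?m 0) {0..stage_time r j}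
      \<and> ?F absolutely_integrable_on {0..stage_time r j}" if "j \<le> num_stages r" for j
    using that
  proof (induction j)
    case 0
    have "?F absolutely_integrable_on {0..0}"
      by (rule absolutely_integrable_continuous_real) simp
    then show ?case
      using admissible_start_0[OF run assms(8,7,9)] t_0 by (simp add: has_integral_refl)
  next
    case (Suc j)
    then have adm: "admissible_start N r j" and j: "j < num_stages r"
      and IH: "(?F has_integral ?m j - ?m 0) {0..stage_time r j}"
        "?F absolutely_integrable_on {0..stage_time r j}" by auto
    interpret tested_stage f L T N r j \<phi> \<psi> \<phi>x \<phi>t C by (rule stage[OF j adm])
    have "(?F has_integral (?m j - ?m 0) + (?m (j + 1) - ?m j)) {0..stage_time r (j + 1)}"
      by (rule has_integral_combine[OF time_nonneg less_imp_le[OF s_less] IH(1) stage_integral(1)])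
    moreover have "?F absolutely_integrable_on {0..stage_time r (j + 1)}"
      by (rule absolutely_integrable_on_combine[OF IH(2) stage_integral(2) time_nonneg less_imp_le[OF s_less]])
    ultimately show ?case using admissible_end by simp
  qed
  from this[OF order_refl] have int: "(?F has_integral ?m (num_stages r) - ?m 0) {0..T}"
    and abs: "?F absolutely_integrable_on {0..T}" by (simp_all add: t_final)
  have "cell_mean \<psi> a b T = 0" for a b
    by (simp add: cell_mean_def extended_test_function.\<psi>_final[OF ext])
  then have "?m (num_stages r) = 0" by (simp add: weighted_mass_def t_final)
  then have I: "(LINT t:{0..T}|lebesgue. ?F t) = - ?m 0"
    using int set_lebesgue_integral_eq_integral(2)[OF abs] by (simp add: integral_unique)
  have "0 < num_stages r" using t_final t_0 assms(1) by (cases "num_stages r") auto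
  then interpret tested_stage f L T N r 0 \<phi> \<psi> \<phi>x \<phi>t C
    using stage admissible_start_0[OF run assms(8,7,9)] by blast
  have "?m 0 = (LINT x|lebesgue. \<phi> (x, 0) * initial_approx u0 N x0 x)"
    using weighted_mass_start t_0 initial_approx_eq[OF run assms(1,8)] by simp
  then show ?thesis using I by (simp add: weak_integrand_def)
qed

end
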